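(* Suppose that $\mathbf U^\imath$ satisfies the condition (IC): for every word $w$ one has $B_w=\sum_{g\in\mathcal G(\mathbf U^\imath),\,g\preceq w}c_{g,w}B_g$ with all $c_{g,w}\in\mathbb Z[q,q^{-1}]$. Then there exists a unique basis $\mathbf B_{can}=\{C_g\mid g\in\mathcal G(\mathbf U^\imath)\}$ of $\mathbf U^\imath$ such that, for each $g\in\mathcal G(\mathbf U^\imath)$, (1) $\overline{C_g}=C_g$; (2) $C_g=B_{[g]}+\sum_{w\in\mathcal G(\mathbf U^\imath),\,w\prec g}p_{g,w}B_{[w]}$, where $p_{g,w}\in q\mathbb Z[q]$.
   Context: Algebra. Let $\mathfrak g$ be a complex simple Lie algebra of rank $n$ with fixed simple roots $\alpha_1,\dots,\alpha_n$, and let $(\cdot,\cdot)$ be the symmetric Weyl-invariant bilinear form on the root lattice, normalised so that short roots satisfy $(\alpha,\alpha)=2$. Put $a_{ij}=2(\alpha_i,\alpha_j)/(\alpha_i,\alpha_i)$, $d_i=(\alpha_i,\alpha_i)/2$. Let $q\in\mathbb C$ be transcendental over $\mathbb{Q}$ (equivalently, an indeterminate), $q_i=q^{d_i}$, $[k]_i=(q_i^k-q_i^{-k})/(q_i-q_i^{-1})$, with the usual quantum binomials. $\mathbf U=U_q(\mathfrak g)$ is the $\mathbb Q(q)$-algebra with generators $E_i,F_i,K_i^{\pm1}$ and relations $K_iK_i^{-1}=K_i^{-1}K_i=1$, $K_iK_j=K_jK_i$, $K_iE_jK_i^{-1}=q_i^{a_{ij}}E_j$, $K_iF_jK_i^{-1}=q_i^{-a_{ij}}F_j$,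 $E_iF_j-F_jE_i=\delta_{ij}\frac{K_i-K_i^{-1}}{q_i-q_i^{-1}}$, and, for $i\ne j$, the quantum Serre relations $\sum_{k=0}^{1-a_{ij}}(-1)^k\begin{bmatrix}1-a_{ij}\\k\end{bmatrix}_i x_i^{1-a_{ij}-k}x_jx_i^k=0$ for $x=E$ and $x=F$. $\mathbf U^\imath$ is the $\mathbb Q(q)$-subalgebra of $\mathbf U$ generated by $B_i=F_i+\xi_iE_iK_i^{-1}$, $1\le i\le n$, where the parameters $\xi_i\in\mathbb Q(q)^\times$ are such that the bar involution $\overline{\,\cdot\,}$ exists, i.e. there is a (unique) $\mathbb Q$-algebra automorphism of $\mathbf U^\imath$ with $\overline{B_i}=B_i$ and $\overline q=q^{-1}$ (e.g. $\xi_i=q_i^{-1}$). Words. Let $T(V)$ be the free associative $\mathbb Q(q)$-algebra on letters $v_1,\dots,v_n$. For a word $w=v_{i_1}\cdots v_{i_k}$ put $\ell(w)=k$, $|w|=\alpha_{i_1}+\cdots+\alpha_{i_k}$, $B_w=B_{i_1}\cdots B_{i_k}$ ($B_\emptyset=1$), extended linearly to $B_x$ for $x\in T(V)$. The order $<$ is lexicographic with $v_1<\cdots<v_n$, a proper prefix being smaller; $x\prec y$ means $\ell(x)<\ell(y)$, or $\ell(x)=\ell(y)$ and $x>y$. A nonempty word is Lyndon if it is a letter or is $<$ each of its proper nonempty suffixes. Every word factors uniquely as $w=l_1\cdots l_m$ with $l_i$ Lyndon and $l_1\ge\cdots\ge l_m$. A word $g$ is $\mathbf U^\imath$-good if $B_g$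 is not a $\mathbb Q(q)$-linear combination of the $B_w$ with $w\prec g$; the empty word is counted as good. $\mathcal G(\mathbf U^\imath)$ is the set of good words; $\mathbf B_{\mathcal G}=\{B_g\mid g\in\mathcal G(\mathbf U^\imath)\}$ is a basis of $\mathbf U^\imath$. Bracketing. Extend bilinearly $[x,y]_{q^{-1}}=xy-q^{-(|x|,|y|)}yx$ for words $x,y$. For a Lyndon word $l$ put $[l]=l$ if $l$ is a letter; otherwise write $l=l_1l_2$ with $l_1$ the longest proper Lyndon prefix of $l$ and put $[l]=[[l_1],[l_2]]_{q^{-1}}$. For a word $w$ with its unique factorization $w=l_1\cdots l_m$ into Lyndon words $l_1\ge\cdots\ge l_m$, put $[w]=[l_1]\cdots[l_m]$ ($[\emptyset]=1$). *)

theory Defs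
  imports
    "HOL-Analysis.Linear_Algebra"
    "HOL-Library.FuncSet"
    "HOL-Library.Poly_Mapping"
    "HOL-Computational_Algebra.Polynomial"
    "HOL-Computational_Algebra.Fraction_Field"
    "HOL-Algebra.QuotRing"
    "HOL-Algebra.Generated_Rings"
begin

section \<open>The field of rational functions in an indeterminate\<close>

type_synonym qfield = "rat poly fract"

definition qq :: qfield where
  "qq = Fract [:0, 1:] 1"

definition int_qpolys :: "qfield set" where
  "int_qpolys = {poly (map_poly of_int p) qq |p :: int poly. True}"

definition int_laurent :: "qfield set" where
  "int_laurent = {x * qq powi (- int m) |x m. x \<in> int_qpolys}"

definition q_int_qpolys :: "qfield set" where
  "q_int_qpolys = {qq * x |x. x \<in> int_qpolys}"

definition qint :: "qfield \<Rightarrow> nat \<Rightarrow> qfield" where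
  "qint v k = (v ^ k - inverse v ^ k) / (v - inverse v)"

definition qfact :: "qfield \<Rightarrow> nat \<Rightarrow> qfield" where
  "qfact v k = (\<Prod>m = 1..k. qint v m)"

definition qbinom :: "qfield \<Rightarrow> nat \<Rightarrow> nat \<Rightarrow> qfield" where
  "qbinom v m k = qfact v m / (qfact v k * qfact v (m - k))"


section \<open>Root systems and simple roots\<close>

text \<open>A complex simple Lie algebra with fixed simple roots enters only through its root
  system, which is a reduced irreducible crystallographic root system together with a base. The
  ambient inner product is invariant under the reflections, hence restricts to the Weyl-invariant
  form on the root lattice; it is scaled so that the roots of minimal length have square
  length 2.\<close>

definition root_reflection :: "'v::euclidean_space \<Rightarrow> 'v \<Rightarrow> 'v" where
  "root_reflection a x = x - (2 * (a \<bullet> x) / (a \<bullet> a)) *\<^sub>R a"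

definition root_system :: "'v::euclidean_space set \<Rightarrow> bool" where
  "root_system \<Phi> \<longleftrightarrow>
     finite \<Phi> \<and> 0 \<notin> \<Phi> \<and> span \<Phi> = UNIV \<and>
     (\<forall>a\<in>\<Phi>. \<forall>b\<in>\<Phi>. root_reflection a b \<in> \<Phi>) \<and>
     (\<forall>a\<in>\<Phi>. \<forall>b\<in>\<Phi>. 2 * (a \<bullet> b) / (a \<bullet> a) \<in> \<int>) \<and>
     (\<forall>a\<in>\<Phi>. \<forall>c. c *\<^sub>R a \<in> \<Phi> \<longrightarrow> c = 1 \<or> c = -1)"

definition irreducible_roots :: "'v::euclidean_space set \<Rightarrow> bool" where
  "irreducible_roots \<Phi> \<longleftrightarrow> \<Phi> \<noteq> {} \<and>
     \<not> (\<exists>A B. A \<noteq> {} \<and> B \<noteq> {} \<and> A \<union> B = \<Phi> \<and> A \<inter> B = {} \<and> (\<forall>a\<in>A. \<forall>b\<in>B. a \<bullet> b = 0))"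

definition short_roots :: "'v::euclidean_space set \<Rightarrow> 'v set" where
  "short_roots \<Phi> = {a \<in> \<Phi>. \<forall>b\<in>\<Phi>. a \<bullet> a \<le> b \<bullet> b}"

definition simple_roots :: "'v::euclidean_space set \<Rightarrow> ('i::finite \<Rightarrow> 'v) \<Rightarrow> bool" where
  "simple_roots \<Phi> \<alpha> \<longleftrightarrow>
     inj \<alpha> \<and> range \<alpha> \<subseteq> \<Phi> \<and> independent (range \<alpha>) \<and>
     (\<forall>b\<in>\<Phi>. \<exists>c :: 'i \<Rightarrow> nat.
        b = (\<Sum>i\<in>UNIV. real (c i) *\<^sub>R \<alpha> i) \<or> b = - (\<Sum>i\<in>UNIV. real (c i) *\<^sub>R \<alpha> i))"

definition simple_lie_root_datum :: "'v::euclidean_space set \<Rightarrow> ('i::finite \<Rightarrow> 'v) \<Rightarrow> bool" where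
  "simple_lie_root_datum \<Phi> \<alpha> \<longleftrightarrow>
     root_system \<Phi> \<and> irreducible_roots \<Phi> \<and> (\<forall>a\<in>short_roots \<Phi>. a \<bullet> a = 2) \<and> simple_roots \<Phi> \<alpha>"

text \<open>With this normalisation the three real numbers below are integers, so that the floors are
  exact; they only convert the type, as exponents of \<open>q\<close> are of type \<^typ>\<open>int\<close>.\<close>

definition cartan :: "('i \<Rightarrow> 'v::euclidean_space) \<Rightarrow> 'i \<Rightarrow> 'i \<Rightarrow> int" where
  "cartan \<alpha> i j = \<lfloor>2 * (\<alpha> i \<bullet> \<alpha> j) / (\<alpha> i \<bullet> \<alpha> i)\<rfloor>"

definition half_length :: "('i \<Rightarrow> 'v::euclidean_space) \<Rightarrow> 'i \<Rightarrow> int" where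
  "half_length \<alpha> i = \<lfloor>(\<alpha> i \<bullet> \<alpha> i) / 2\<rfloor>"

definition lattice_form :: "'v::euclidean_space \<Rightarrow> 'v \<Rightarrow> int" where
  "lattice_form x y = \<lfloor>x \<bullet> y\<rfloor>"

definition qi :: "('i \<Rightarrow> 'v::euclidean_space) \<Rightarrow> 'i \<Rightarrow> qfield" where
  "qi \<alpha> i = qq powi half_length \<alpha> i"


section \<open>Free associative algebras\<close>

text \<open>Lists form the free monoid under concatenation. With this instance the convolution product
  on finitely supported functions makes \<open>'x list \<Rightarrow>\<^sub>0 qfield\<close> the free associative algebra on the
  letters \<open>'x\<close>.\<close>

instantiation list :: (type) monoid_add
begin

definition zero_list :: "'a list" where
  "0 = []"

definition plus_list :: "'a list \<Rightarrow> 'a list \<Rightarrow> 'a list" where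
  "xs + ys = xs @ ys"

instance
  by standard (simp_all add: zero_list_def plus_list_def)

end

type_synonym 'x free_alg = "'x list \<Rightarrow>\<^sub>0 qfield"

definition word_elt :: "'x list \<Rightarrow> 'x free_alg" where
  "word_elt w = Poly_Mapping.single w 1"

definition scalar :: "qfield \<Rightarrow> 'x free_alg" where
  "scalar c = Poly_Mapping.single [] c"

definition free_alg_ring :: "'x free_alg ring" where
  "free_alg_ring = \<lparr>carrier = UNIV, monoid.mult = (*), one = 1, ring.zero = 0, add = (+)\<rparr>"


section \<open>The quantum group\<close>

datatype 'i qgen = gE 'i | gF 'i | gK 'i | gKinv 'i

abbreviation gen :: "'i qgen \<Rightarrow> 'i qgen free_alg" where
  "gen x \<equiv> word_elt [x]"

definition serre :: "('i \<Rightarrow> 'v::euclidean_space) \<Rightarrow> ('i \<Rightarrow> 'i qgen) \<Rightarrow> 'i \<Rightarrow> 'i \<Rightarrow> 'i qgen free_alg" where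
  "serre \<alpha> X i j =
     (let m = nat (1 - cartan \<alpha> i j)
      in \<Sum>k\<le>m. scalar ((-1) ^ k * qbinom (qi \<alpha> i) m k) * gen (X i) ^ (m - k) * gen (X j) * gen (X i) ^ k)"

definition qgroup_relators :: "('i \<Rightarrow> 'v::euclidean_space) \<Rightarrow> 'i qgen free_alg set" where
  "qgroup_relators \<alpha> =
     {gen (gK i) * gen (gKinv i) - 1 |i. True} \<union>
     {gen (gKinv i) * gen (gK i) - 1 |i. True} \<union>
     {gen (gK i) * gen (gK j) - gen (gK j) * gen (gK i) |i j. True} \<union>
     {gen (gK i) * gen (gE j) * gen (gKinv i) - scalar (qi \<alpha> i powi cartan \<alpha> i j) * gen (gE j) |i j. True} \<union>
     {gen (gK i) * gen (gF j) * gen (gKinv i) - scalar (qi \<alpha> i powi (- cartan \<alpha> i j)) * gen (gF j) |i j. True} \<union>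
     {gen (gE i) * gen (gF j) - gen (gF j) * gen (gE i)
        - (if i = j then scalar (1 / (qi \<alpha> i - inverse (qi \<alpha> i))) * (gen (gK i) - gen (gKinv i)) else 0)
        |i j. True} \<union>
     {serre \<alpha> gE i j |i j. i \<noteq> j} \<union>
     {serre \<alpha> gF i j |i j. i \<noteq> j}"

definition qgroup_ideal :: "('i \<Rightarrow> 'v::euclidean_space) \<Rightarrow> 'i qgen free_alg set" where
  "qgroup_ideal \<alpha> = Idl\<^bsub>free_alg_ring\<^esub> (qgroup_relators \<alpha>)"

type_synonym 'i qgroup_elt = "'i qgen free_alg set"

definition qgroup :: "('i \<Rightarrow> 'v::euclidean_space) \<Rightarrow> 'i qgroup_elt ring" where
  "qgroup \<alpha> = free_alg_ring Quot (qgroup_ideal \<alpha>)"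

definition qclass :: "('i \<Rightarrow> 'v::euclidean_space) \<Rightarrow> 'i qgen free_alg \<Rightarrow> 'i qgroup_elt" where
  "qclass \<alpha> x = qgroup_ideal \<alpha> +>\<^bsub>free_alg_ring\<^esub> x"

definition qsmult :: "('i \<Rightarrow> 'v::euclidean_space) \<Rightarrow> qfield \<Rightarrow> 'i qgroup_elt \<Rightarrow> 'i qgroup_elt" where
  "qsmult \<alpha> c u = qclass \<alpha> (scalar c) \<otimes>\<^bsub>qgroup \<alpha>\<^esub> u"

text \<open>The linear combination of the family \<open>b\<close> with the finitely supported coefficients \<open>c\<close>.\<close>

definition lincomb ::
  "('i \<Rightarrow> 'v::euclidean_space) \<Rightarrow> ('x \<Rightarrow> 'i qgroup_elt) \<Rightarrow> ('x \<Rightarrow>\<^sub>0 qfield) \<Rightarrow> 'i qgroup_elt" where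
  "lincomb \<alpha> b c = (\<Oplus>\<^bsub>qgroup \<alpha>\<^esub>x\<in>Poly_Mapping.keys c. qsmult \<alpha> (Poly_Mapping.lookup c x) (b x))"


section \<open>The subalgebra generated by the elements B\<close>

definition B_gen :: "('i \<Rightarrow> 'v::euclidean_space) \<Rightarrow> ('i \<Rightarrow> qfield) \<Rightarrow> 'i \<Rightarrow> 'i qgroup_elt" where
  "B_gen \<alpha> \<xi> i = qclass \<alpha> (gen (gF i) + scalar (\<xi> i) * gen (gE i) * gen (gKinv i))"

text \<open>A subring containing the scalars is a subalgebra, so that the following is the subalgebra
  generated by the elements \<^term>\<open>B_gen \<alpha> \<xi> i\<close>.\<close>

definition iqgroup_carrier :: "('i \<Rightarrow> 'v::euclidean_space) \<Rightarrow> ('i \<Rightarrow> qfield) \<Rightarrow> 'i qgroup_elt set" where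
  "iqgroup_carrier \<alpha> \<xi> =
     generate_ring (qgroup \<alpha>) (range (\<lambda>c. qclass \<alpha> (scalar c)) \<union> range (B_gen \<alpha> \<xi>))"

definition iqgroup :: "('i \<Rightarrow> 'v::euclidean_space) \<Rightarrow> ('i \<Rightarrow> qfield) \<Rightarrow> 'i qgroup_elt ring" where
  "iqgroup \<alpha> \<xi> = (qgroup \<alpha>)\<lparr>carrier := iqgroup_carrier \<alpha> \<xi>\<rparr>"

definition bar_involution ::
  "('i \<Rightarrow> 'v::euclidean_space) \<Rightarrow> ('i \<Rightarrow> qfield) \<Rightarrow> ('i qgroup_elt \<Rightarrow> 'i qgroup_elt) \<Rightarrow> bool" where
  "bar_involution \<alpha> \<xi> bar \<longleftrightarrow>
     bar \<in> ring_iso (iqgroup \<alpha> \<xi>) (iqgroup \<alpha> \<xi>) \<and>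
     (\<forall>r :: rat. \<forall>u \<in> carrier (iqgroup \<alpha> \<xi>).
        bar (qsmult \<alpha> (of_rat r) u) = qsmult \<alpha> (of_rat r) (bar u)) \<and>
     (\<forall>i. bar (B_gen \<alpha> \<xi> i) = B_gen \<alpha> \<xi> i) \<and>
     bar (qclass \<alpha> (scalar qq)) = qclass \<alpha> (scalar (inverse qq))"

text \<open>Uniqueness of the coefficients makes the family linearly independent, in particular injective
  on \<open>G\<close>.\<close>

definition iq_basis ::
  "('i \<Rightarrow> 'v::euclidean_space) \<Rightarrow> ('i \<Rightarrow> qfield) \<Rightarrow> 'x set \<Rightarrow> ('x \<Rightarrow> 'i qgroup_elt) \<Rightarrow> bool" where
  "iq_basis \<alpha> \<xi> G b \<longleftrightarrow>
     (\<forall>x\<in>G. b x \<in> carrier (iqgroup \<alpha> \<xi>)) \<and>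
     (\<forall>u\<in>carrier (iqgroup \<alpha> \<xi>). \<exists>!c. Poly_Mapping.keys c \<subseteq> G \<and> u = lincomb \<alpha> b c)"


section \<open>Words\<close>

definition word_less :: "'i::linorder list \<Rightarrow> 'i list \<Rightarrow> bool" where
  "word_less x y \<longleftrightarrow> (x, y) \<in> lexord {(a, b). a < b}"

definition word_prec :: "'i::linorder list \<Rightarrow> 'i list \<Rightarrow> bool" where
  "word_prec x y \<longleftrightarrow> length x < length y \<or> (length x = length y \<and> word_less y x)"

definition lyndon :: "'i::linorder list \<Rightarrow> bool" where
  "lyndon w \<longleftrightarrow> w \<noteq> [] \<and> (\<forall>u v. w = u @ v \<and> u \<noteq> [] \<and> v \<noteq> [] \<longrightarrow> word_less w v)"

definition lyndon_factorization :: "'i::linorder list \<Rightarrow> 'i list list" where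
  "lyndon_factorization w =
     (THE ls. concat ls = w \<and> (\<forall>l\<in>set ls. lyndon l) \<and>
        sorted_wrt (\<lambda>x y. x = y \<or> word_less y x) ls)"

definition word_weight :: "('i \<Rightarrow> 'v::euclidean_space) \<Rightarrow> 'i list \<Rightarrow> 'v" where
  "word_weight \<alpha> w = sum_list (map \<alpha> w)"

definition B_word :: "('i \<Rightarrow> 'v::euclidean_space) \<Rightarrow> ('i \<Rightarrow> qfield) \<Rightarrow> 'i list \<Rightarrow> 'i qgroup_elt" where
  "B_word \<alpha> \<xi> w = foldr (\<lambda>i u. B_gen \<alpha> \<xi> i \<otimes>\<^bsub>qgroup \<alpha>\<^esub> u) w \<one>\<^bsub>qgroup \<alpha>\<^esub>"

definition B_elt :: "('i \<Rightarrow> 'v::euclidean_space) \<Rightarrow> ('i \<Rightarrow> qfield) \<Rightarrow> 'i free_alg \<Rightarrow> 'i qgroup_elt" where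
  "B_elt \<alpha> \<xi> x = lincomb \<alpha> (B_word \<alpha> \<xi>) x"

definition good_words ::
  "('i::linorder \<Rightarrow> 'v::euclidean_space) \<Rightarrow> ('i \<Rightarrow> qfield) \<Rightarrow> 'i list set" where
  "good_words \<alpha> \<xi> =
     {g. g = [] \<or>
         \<not> (\<exists>c. Poly_Mapping.keys c \<subseteq> {w. word_prec w g} \<and> B_word \<alpha> \<xi> g = lincomb \<alpha> (B_word \<alpha> \<xi>) c)}"

definition integrality_condition ::
  "('i::linorder \<Rightarrow> 'v::euclidean_space) \<Rightarrow> ('i \<Rightarrow> qfield) \<Rightarrow> bool" where
  "integrality_condition \<alpha> \<xi> \<longleftrightarrow>
     (\<forall>w. \<exists>c. Poly_Mapping.keys c \<subseteq> {g \<in> good_words \<alpha> \<xi>. word_prec g w \<or> g = w} \<and>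
        (\<forall>g. Poly_Mapping.lookup c g \<in> int_laurent) \<and> B_word \<alpha> \<xi> w = lincomb \<alpha> (B_word \<alpha> \<xi>) c)"


section \<open>Bracketing\<close>

definition qbracket ::
  "('i \<Rightarrow> 'v::euclidean_space) \<Rightarrow> 'i free_alg \<Rightarrow> 'i free_alg \<Rightarrow> 'i free_alg" where
  "qbracket \<alpha> x y =
     (\<Sum>u\<in>Poly_Mapping.keys x. \<Sum>v\<in>Poly_Mapping.keys y. scalar (Poly_Mapping.lookup x u * Poly_Mapping.lookup y v) *
        (word_elt (u @ v)
          - scalar (qq powi (- lattice_form (word_weight \<alpha> u) (word_weight \<alpha> v))) * word_elt (v @ u)))"

text \<open>The length of the longest proper Lyndon prefix; the bracketing below is recursive on words of
  length at least 2, and only its values on Lyndon words matter.\<close>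

definition lyndon_split :: "'i::linorder list \<Rightarrow> nat" where
  "lyndon_split l = Max {k. 0 < k \<and> k < length l \<and> lyndon (take k l)}"

lemma lyndon_split_bounds:
  assumes "1 < length l"
  shows "0 < lyndon_split l" "lyndon_split l < length l"
proof -
  let ?S = "{k. 0 < k \<and> k < length l \<and> lyndon (take k l)}"
  have "lyndon (take 1 l)"
    using assms by (cases l) (auto simp: lyndon_def Cons_eq_append_conv)
  then have "1 \<in> ?S"
    using assms by simp
  moreover have "finite ?S"
    by (rule finite_subset[of _ "{..<length l}"]) auto
  ultimately have "Max ?S \<in> ?S"
    by (intro Max_in) blast+
  then show "0 < lyndon_split l" "lyndon_split l < length l"
    by (auto simp: lyndon_split_def)
qed

function lyndon_bracket ::
  "('i::linorder \<Rightarrow> 'v::euclidean_space) \<Rightarrow> 'i list \<Rightarrow> 'i free_alg" where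
  "lyndon_bracket \<alpha> l =
     (if length l \<le> 1 then word_elt l
      else qbracket \<alpha> (lyndon_bracket \<alpha> (take (lyndon_split l) l))
                      (lyndon_bracket \<alpha> (drop (lyndon_split l) l)))"
  by pat_completeness auto
termination
  by (relation "Wellfounded.measure (\<lambda>(\<alpha>, l). length l)") (auto simp: not_le lyndon_split_bounds intro!: diff_less)

declare lyndon_bracket.simps [simp del]

definition word_bracket ::
  "('i::linorder \<Rightarrow> 'v::euclidean_space) \<Rightarrow> 'i list \<Rightarrow> 'i free_alg" where
  "word_bracket \<alpha> w = prod_list (map (lyndon_bracket \<alpha>) (lyndon_factorization w))"

end

theory Submission
  imports Defs
begin

text \<open>Let \<open>L\<close> be the algebra homomorphism \<^const>\<open>B_elt\<close> from the free algebra on the letters onto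
  the subalgebra generated by the elements B. The bar involution fixes every \<open>L w\<close>, \<open>w\<close> a
  word, and acts on the scalars by the automorphism \<open>\<sigma>\<close> with \<open>\<sigma> q = q\<^sup>-\<^sup>1\<close>; hence in coordinates
  with respect to the words it is just \<open>\<sigma>\<close> applied to each coefficient. The good words are a
  basis: they are independent because a relation would express its largest word by smaller ones,
  and the integrality condition rewrites every word as an integral Laurent combination of smaller or
  equal good words. So everything takes place in the space of finitely supported coefficient
  functions on the good words, with the involution acting coefficientwise.

  In these coordinates the bracketings form a unitriangular family with coefficients in
  \<open>\<int>[q, q\<^sup>-\<^sup>1]\<close>. For a Lyndon word \<open>l = u v\<close> with \<open>u\<close> its longest proper Lyndon prefix, \<open>v\<close> is
  again Lyndon and \<open>u v < v u\<close>, so that induction gives \<open>[l] = l +\<close> a Laurent combination of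
  lexicographically larger words of the same length; this property survives products
  (\<open>leads_word_bracket\<close>). Larger words of the same length are smaller for \<^const>\<open>word_prec\<close>, and
  rewriting them in good words keeps them smaller.

  For such a family the argument of Kazhdan and Lusztig applies. It needs two facts on
  \<open>\<int>[q, q\<^sup>-\<^sup>1]\<close>: each element becomes \<open>\<sigma>\<close>-invariant after adding an element of \<open>q\<int>[q]\<close>
  (\<open>int_laurent_correction\<close>), and \<open>0\<close> is the only \<open>\<sigma>\<close>-invariant element of \<open>q\<int>[q]\<close>
  (\<open>fixed_q_int_qpolys_eq_0\<close>). Going down from the largest word, the first fact lets one correct
  the coefficients of \<open>[g]\<close> one at a time by multiples of smaller bracketings, which never disturbs
  the coefficients already made invariant. For uniqueness, the largest coefficient of the difference
  of two solutions is an invariant element of \<open>q\<int>[q]\<close>, so it vanishes by the second fact.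

  Independence of the empty word, which is good by convention, means that the quantum group is
  nonzero; the counit shows this.\<close>


section \<open>Lyndon words\<close>

lemma word_less_irrefl [simp]: "\<not> word_less x x"
  by (simp add: word_less_def lexord_irreflexive)

lemma word_less_trans [trans]: "word_less x y \<Longrightarrow> word_less y z \<Longrightarrow> word_less x z"
  unfolding word_less_def by (rule lexord_trans) (auto simp: trans_def)

lemma word_less_linear: "word_less x y \<or> x = y \<or> word_less y x"
  unfolding word_less_def by (rule lexord_linear) auto

lemma word_less_append_left [simp]: "word_less (x @ u) (x @ v) \<longleftrightarrow> word_less u v"
  by (simp add: word_less_def irrefl_def)

lemma word_less_prefix: "v \<noteq> [] \<Longrightarrow> word_less u (u @ v)"
  using word_less_append_left[of u "[]" v] by (cases v) (auto simp: word_less_def)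

lemma word_less_append:
  "word_less u v \<Longrightarrow> length v \<le> length u \<Longrightarrow> word_less (u @ x) (v @ y)"
  unfolding word_less_def by (rule lexord_sufI)

text \<open>A word is smaller than another one either as a proper prefix or at a letter where the two
  differ; in the second case the comparison persists whatever is appended to the two words.\<close>

lemma word_less_cases:
  assumes "word_less u v"
  obtains (prefix) z where "v = u @ z" "z \<noteq> []"
  | (differ) "\<And>x y. word_less (u @ x) (v @ y)"
proof -
  from assms consider (1) a z where "v = u @ a # z"
    | (2) p a b s t where "a < b" "u = p @ a # s" "v = p @ b # t"
    unfolding word_less_def lexord_def by auto
  then show thesis
  proof cases
    case 1
    then show thesis by (intro prefix[of "a # z"]) auto
  next
    case 2
    then have "word_less (u @ x) (v @ y)" for x y
      by (auto simp: word_less_def irrefl_def)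
    then show thesis by (rule differ)
  qed
qed

lemma lyndon_less_suffix: "lyndon (u @ v) \<Longrightarrow> u \<noteq> [] \<Longrightarrow> v \<noteq> [] \<Longrightarrow> word_less (u @ v) v"
  by (simp add: lyndon_def)

text \<open>A Lyndon word differs from each of its proper suffixes at some letter, since it is too long to be
  a prefix of the suffix. In particular \<open>u v < v u\<close>.\<close>

lemma lyndon_append_less:
  assumes "lyndon (u @ v)" "u \<noteq> []" "v \<noteq> []"
  shows "word_less (u @ v @ x) (v @ y)"
  using lyndon_less_suffix[OF assms]
proof (cases rule: word_less_cases)
  case (prefix z)
  then have "length v = length u + length v + length z"
    by (metis length_append)
  with prefix show ?thesis by simp
next
  case differ
  show ?thesis using differ[of x y] by simp
qed

text \<open>A proper suffix of \<open>u v\<close> either lies in \<open>v\<close>, and then is at least \<open>v > u v\<close>, or has the form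
  \<open>t v\<close> for a proper suffix \<open>t\<close> of \<open>u\<close>, and then \<open>u < t\<close> is decided at a letter of \<open>t\<close>.\<close>

lemma lyndon_append:
  assumes u: "lyndon u" and v: "lyndon v" and uv: "word_less u v"
  shows "lyndon (u @ v)"
proof -
  have ne: "u \<noteq> []" "v \<noteq> []" using u v by (auto simp: lyndon_def)
  have uvv: "word_less (u @ v) v"
    using uv
  proof (cases rule: word_less_cases)
    \<comment> \<open>Here \<open>v = u z\<close> and \<open>v < z\<close>; putting \<open>u\<close> in front gives \<open>u v < u z = v\<close>.\<close>
    case (prefix z)
    then have "word_less v z" using v ne by (simp add: lyndon_def)
    then show ?thesis using prefix by (metis word_less_append_left)
  next
    case differ
    show ?thesis using differ[of v "[]"] by simp
  qed
  have "word_less (u @ v) s" if ps: "u @ v = p @ s" "p \<noteq> []" "s \<noteq> []" for p s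
  proof -
    from ps(1) consider t where "p = u @ t" "v = t @ s" | t where "u = p @ t" "s = t @ v"
      by (auto simp: append_eq_append_conv2)
    then show ?thesis
    proof cases
      case 1
      then show ?thesis
        using uvv v ps(3) word_less_trans[of "u @ v" v s] by (cases "t = []") (auto simp: lyndon_def)
    next
      case 2
      then show ?thesis
        using uvv lyndon_append_less[of p t v v] u ps by (cases "t = []") auto
    qed
  qed
  then show ?thesis using ne by (auto simp: lyndon_def)
qed

abbreviation is_lyndon_factorization :: "'i::linorder list \<Rightarrow> 'i list list \<Rightarrow> bool" where
  "is_lyndon_factorization w ls \<equiv> concat ls = w \<and> (\<forall>l\<in>set ls. lyndon l) \<and>
     sorted_wrt (\<lambda>x y. x = y \<or> word_less y x) ls"

text \<open>A Lyndon word put in front of a nonincreasing sequence is merged with the first factor as long as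
  it is smaller than that factor.\<close>

lemma lyndon_factorization_exists_Cons:
  assumes "lyndon u" "\<forall>l\<in>set ls. lyndon l" "sorted_wrt (\<lambda>x y. x = y \<or> word_less y x) ls"
  shows "\<exists>ms. is_lyndon_factorization (u @ concat ls) ms"
  using assms
proof (induction ls arbitrary: u)
  case Nil
  then show ?case by (intro exI[of _ "[u]"]) simp
next
  case (Cons m ls)
  show ?case
  proof (cases "word_less u m")
    case True
    then have "lyndon (u @ m)" using Cons.prems by (intro lyndon_append) auto
    from Cons.IH[OF this] Cons.prems show ?thesis by simp
  next
    case False
    then have "u = m \<or> word_less m u" using word_less_linear[of u m] by auto
    then have "is_lyndon_factorization (u @ concat (m # ls)) (u # m # ls)"
      using Cons.prems by (auto intro: word_less_trans)
    then show ?thesis by blast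
  qed
qed

lemma lyndon_factorization_exists: "\<exists>ls. is_lyndon_factorization w ls"
proof (induction w)
  case Nil
  show ?case by (intro exI[of _ "[]"]) simp
next
  case (Cons a w)
  have "lyndon [a]" by (auto simp: lyndon_def Cons_eq_append_conv)
  moreover obtain ls where "is_lyndon_factorization w ls" using Cons by blast
  ultimately show ?case using lyndon_factorization_exists_Cons[of "[a]" ls] by simp
qed

text \<open>The first factor of a Lyndon factorization is the longest Lyndon prefix of the word, which makes
  the factorization unique. A longer Lyndon prefix \<open>p\<close> would end inside some later factor \<open>m\<close>, so that
  a prefix \<open>x\<close> of \<open>m\<close> would be a proper suffix of \<open>p\<close>.\<close>

lemma lyndon_prefix_le_first_factor:
  assumes ls: "\<forall>l\<in>set ls. lyndon l" "sorted_wrt (\<lambda>x y. x = y \<or> word_less y x) (l # ls)"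
    and p: "lyndon p" "l @ concat ls = p @ r" and l: "l \<noteq> []"
  shows "length p \<le> length l"
proof (rule ccontr)
  \<comment> \<open>Every nonempty prefix \<open>s\<close> of a concatenation ends with a nonempty prefix \<open>x\<close> of one of the
    factors.\<close>
  have *: "\<exists>x m y. s = y @ x \<and> x \<noteq> [] \<and> m \<in> set ks \<and> (\<exists>z. m = x @ z)"
    if "s \<noteq> []" "concat ks = s @ t" for s t and ks :: "'a list list"
    using that
  proof (induction ks arbitrary: s)
    case Nil
    then show ?case by simp
  next
    case (Cons k ks)
    then have "k @ concat ks = s @ t" by simp
    then consider z where "k = s @ z" | z where "s = k @ z" "concat ks = z @ t"
      by (auto simp: append_eq_append_conv2)
    then show ?case
    proof cases
      case 1
      then show ?thesis using Cons.prems by (intro exI[of _ s] exI[of _ k] exI[of _ "[]"]) auto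
    next
      case 2
      show ?thesis
      proof (cases "z = []")
        case True
        then show ?thesis using 2 Cons.prems by (intro exI[of _ s] exI[of _ k] exI[of _ "[]"]) auto
      next
        case False
        from Cons.IH[OF this 2(2)] obtain x m y where
          "z = y @ x" "x \<noteq> []" "m \<in> set ks" "\<exists>u. m = x @ u" by blast
        then show ?thesis using 2 by (intro exI[of _ x] exI[of _ m] exI[of _ "k @ y"]) auto
      qed
    qed
  qed
  assume "\<not> length p \<le> length l"
  then obtain s where s: "p = l @ s" "s \<noteq> []" "concat ls = s @ r"
    using p(2) by (auto simp: append_eq_append_conv2)
  from *[OF s(2,3)] obtain x m y z where
    x: "s = y @ x" "x \<noteq> []" "m \<in> set ls" "m = x @ z" by blast
  \<comment> \<open>The chain \<open>x \<le> m \<le> l < p < x\<close> is contradictory.\<close>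
  have "word_less p x" using p(1) s x l lyndon_less_suffix[of "l @ y" x] by auto
  moreover have "x = m \<or> word_less x m" using x word_less_prefix[of z x] by (cases "z = []") auto
  moreover have "m = l \<or> word_less m l" using ls(2) x by auto
  moreover have "word_less l p" using s word_less_prefix by auto
  ultimately have "word_less p p" using word_less_trans by blast
  then show False by simp
qed

lemma lyndon_factorization_unique:
  assumes "is_lyndon_factorization w ls" "is_lyndon_factorization w ms"
  shows "ls = ms"
  using assms
proof (induction ls arbitrary: w ms)
  case Nil
  then show ?case by (cases ms) (auto simp: lyndon_def)
next
  case (Cons l ls)
  have l: "l \<noteq> []" using Cons.prems by (auto simp: lyndon_def)
  then obtain m ms' where ms: "ms = m # ms'"
    using Cons.prems by (cases ms) auto
  have m: "m \<noteq> []" using Cons.prems ms by (auto simp: lyndon_def)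
  have eq: "l @ concat ls = m @ concat ms'" using Cons.prems ms by simp
  have "length m \<le> length l"
    using Cons.prems ms eq l by (intro lyndon_prefix_le_first_factor[of ls l m "concat ms'"]) auto
  moreover have "length l \<le> length m"
    using Cons.prems ms eq m by (intro lyndon_prefix_le_first_factor[of ms' m l "concat ls"]) auto
  ultimately have "l = m" "concat ls = concat ms'" using eq by auto
  moreover have "ls = ms'"
    using Cons.prems ms \<open>concat ls = concat ms'\<close> by (intro Cons.IH[of "concat ls"]) auto
  ultimately show ?case using ms by simp
qed

lemma is_lyndon_factorization_lyndon_factorization:
  "is_lyndon_factorization w (lyndon_factorization w)"
proof -
  have "\<exists>!ls. is_lyndon_factorization w ls"
    using lyndon_factorization_exists[of w] by (intro ex_ex1I) (auto intro!: lyndon_factorization_unique[where w = w])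
  from theI'[OF this] show ?thesis by (simp add: lyndon_factorization_def)
qed

text \<open>If the remainder \<open>v\<close> after the longest proper Lyndon prefix \<open>u\<close> had several Lyndon factors, the
  first one, \<open>m\<close>, would either extend \<open>u\<close> to a longer proper Lyndon prefix or continue the nonincreasing
  sequence that starts with \<open>u\<close>; the latter contradicts the uniqueness of the factorization of \<open>l\<close>.\<close>

lemma lyndon_split_lyndon:
  assumes l: "lyndon l" "1 < length l"
  shows "lyndon (take (lyndon_split l) l)" "lyndon (drop (lyndon_split l) l)"
proof -
  let ?S = "{k. 0 < k \<and> k < length l \<and> lyndon (take k l)}"
  have "lyndon (take 1 l)"
    using l(2) by (cases l) (auto simp: lyndon_def Cons_eq_append_conv)
  then have "1 \<in> ?S" using l(2) by simp
  moreover have fin: "finite ?S"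
    by (rule finite_subset[of _ "{..<length l}"]) auto
  ultimately have "Max ?S \<in> ?S" by (intro Max_in) blast+
  then have k: "0 < lyndon_split l" "lyndon_split l < length l" "lyndon (take (lyndon_split l) l)"
    by (auto simp: lyndon_split_def)
  have max: "j \<le> lyndon_split l" if "j < length l" "lyndon (take j l)" for j
  proof (cases "j = 0")
    case False
    then show ?thesis unfolding lyndon_split_def using that fin by (intro Max_ge) auto
  qed simp
  show "lyndon (take (lyndon_split l) l)" by (rule k)
  define u v where "u = take (lyndon_split l) l" and "v = drop (lyndon_split l) l"
  have uv: "l = u @ v" "u \<noteq> []" "v \<noteq> []" using k by (auto simp: u_def v_def)
  have "lyndon u" using k by (simp add: u_def)
  have lu: "length u = lyndon_split l" using k by (simp add: u_def)
  obtain ms where ms: "is_lyndon_factorization v ms" using lyndon_factorization_exists by blast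
  obtain m ms' where m: "ms = m # ms'" using ms uv by (cases ms) auto
  have "ms' = []"
  proof (rule ccontr)
    assume ne: "ms' \<noteq> []"
    have ms'ne: "concat ms' \<noteq> []" using ne ms m by (cases ms') (auto simp: lyndon_def)
    show False
    proof (cases "word_less u m")
      case True
      \<comment> \<open>Then \<open>u @ m\<close> is a longer proper Lyndon prefix.\<close>
      then have "lyndon (u @ m)" using \<open>lyndon u\<close> ms m by (intro lyndon_append) auto
      moreover have "u @ m = take (length (u @ m)) l" "length (u @ m) < length l"
        using uv ms m ms'ne by auto
      ultimately have "length (u @ m) \<le> lyndon_split l" using max by metis
      then have "m = []" using lu by simp
      then show False using ms m by (auto simp: lyndon_def)
    next
      case False
      \<comment> \<open>Then \<open>u # ms\<close> and \<open>[l]\<close> are both the factorization of \<open>l\<close>.\<close>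
      then have "u = m \<or> word_less m u" using word_less_linear[of u m] by auto
      then have "is_lyndon_factorization l (u # ms)"
        using ms m uv(1) \<open>lyndon u\<close> by (auto intro: word_less_trans)
      moreover have "is_lyndon_factorization l [l]" using l by simp
      ultimately have "u # ms = [l]" by (rule lyndon_factorization_unique)
      then show False using m by simp
    qed
  qed
  then have "concat [m] = v" "lyndon m" using ms m by auto
  then show "lyndon (drop (lyndon_split l) l)" by (simp add: v_def)
qed


section \<open>Bar-invariant corrections of unitriangular families\<close>

definition scale :: "'k \<Rightarrow> ('w \<Rightarrow>\<^sub>0 'k::comm_ring_1) \<Rightarrow> 'w \<Rightarrow>\<^sub>0 'k" where
  "scale a x = Poly_Mapping.map ((*) a) x"

definition combo :: "('x \<Rightarrow> 'w \<Rightarrow>\<^sub>0 'k::comm_ring_1) \<Rightarrow> ('x \<Rightarrow>\<^sub>0 'k) \<Rightarrow> 'w \<Rightarrow>\<^sub>0 'k" where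
  "combo b c = (\<Sum>x\<in>Poly_Mapping.keys c. scale (Poly_Mapping.lookup c x) (b x))"

lemma lookup_scale [simp]: "Poly_Mapping.lookup (scale a x) w = a * Poly_Mapping.lookup x w"
  unfolding scale_def by transfer (simp add: when_def)

lemma lookup_eq_0_outside:
  "Poly_Mapping.keys p \<subseteq> S \<Longrightarrow> x \<notin> S \<Longrightarrow> Poly_Mapping.lookup p x = 0"
  by (auto simp: subset_iff in_keys_iff)

lemma keys_diff_subset:
  "Poly_Mapping.keys p \<subseteq> S \<Longrightarrow> Poly_Mapping.keys q \<subseteq> S \<Longrightarrow> Poly_Mapping.keys (p - q) \<subseteq> S"
  by (rule subsetI, rule ccontr) (simp add: in_keys_iff lookup_minus lookup_eq_0_outside)

lemma lookup_combo_superset: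
  assumes "finite S" "Poly_Mapping.keys c \<subseteq> S"
  shows "Poly_Mapping.lookup (combo b c) w = (\<Sum>x\<in>S. Poly_Mapping.lookup c x * Poly_Mapping.lookup (b x) w)"
  unfolding combo_def lookup_sum lookup_scale
  using assms by (intro sum.mono_neutral_left) (auto simp: in_keys_iff)

lemma lookup_combo:
  "Poly_Mapping.lookup (combo b c) w =
     (\<Sum>x\<in>Poly_Mapping.keys c. Poly_Mapping.lookup c x * Poly_Mapping.lookup (b x) w)"
  by (rule lookup_combo_superset) auto

lemma combo_add: "combo b (c + d) = combo b c + combo b d"
proof (rule poly_mapping_eqI)
  fix w
  let ?S = "Poly_Mapping.keys c \<union> Poly_Mapping.keys d"
  have "finite ?S" "Poly_Mapping.keys (c + d) \<subseteq> ?S" by (auto dest: Poly_Mapping.keys_add[THEN subsetD])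
  then show "Poly_Mapping.lookup (combo b (c + d)) w = Poly_Mapping.lookup (combo b c + combo b d) w"
    by (simp add: lookup_combo_superset[of ?S] lookup_add algebra_simps sum.distrib)
qed

lemma combo_uminus: "combo b (- c) = - combo b c"
  by (rule poly_mapping_eqI) (simp add: lookup_combo sum_negf)

lemma combo_diff: "combo b (c - d) = combo b c - combo b d"
  using combo_add[of b c "- d"] by (simp add: combo_uminus)

lemma combo_0 [simp]: "combo b 0 = 0"
  by (simp add: combo_def)

lemma combo_single [simp]: "combo b (Poly_Mapping.single x a) = scale a (b x)"
  by (rule poly_mapping_eqI) (simp add: lookup_combo)

lemma combo_sum: "combo b (sum f S) = (\<Sum>s\<in>S. combo b (f s))"
  by (induction S rule: infinite_finite_induct) (simp_all add: combo_add)

lemma combo_scale: "combo b (scale a c) = scale a (combo b c)"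
proof (rule poly_mapping_eqI)
  fix w
  have "Poly_Mapping.keys (scale a c) \<subseteq> Poly_Mapping.keys c" by (auto simp: in_keys_iff)
  then show "Poly_Mapping.lookup (combo b (scale a c)) w = Poly_Mapping.lookup (scale a (combo b c)) w"
    by (simp add: lookup_combo_superset[of "Poly_Mapping.keys c"] sum_distrib_left mult.assoc)
qed

lemma combo_combo: "combo b (combo f c) = combo (\<lambda>x. combo b (f x)) c"
  unfolding combo_def[of f c] combo_sum combo_scale by (simp add: combo_def)

lemma keys_combo:
  "Poly_Mapping.keys (combo b c) \<subseteq> (\<Union>x\<in>Poly_Mapping.keys c. Poly_Mapping.keys (b x))"
proof
  fix w assume "w \<in> Poly_Mapping.keys (combo b c)"
  then have "(\<Sum>x\<in>Poly_Mapping.keys c. Poly_Mapping.lookup c x * Poly_Mapping.lookup (b x) w) \<noteq> 0"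
    by (simp add: in_keys_iff lookup_combo)
  then obtain x where "x \<in> Poly_Mapping.keys c" "Poly_Mapping.lookup (b x) w \<noteq> 0"
    by (metis (no_types, lifting) mult_zero_right sum.neutral)
  then show "w \<in> (\<Union>x\<in>Poly_Mapping.keys c. Poly_Mapping.keys (b x))"
    by (auto simp: in_keys_iff)
qed

locale well_order_relation =
  fixes prec :: "'w \<Rightarrow> 'w \<Rightarrow> bool"
  assumes wf_prec: "wfP prec"
    and trans_prec: "prec x y \<Longrightarrow> prec y z \<Longrightarrow> prec x z"
    and total_prec: "x \<noteq> y \<Longrightarrow> prec x y \<or> prec y x"
begin

lemma irrefl_prec: "\<not> prec x x"
  using wfp_imp_asymp[OF wf_prec] by (auto dest: asympD)

lemma max_key:
  assumes "(x :: 'w \<Rightarrow>\<^sub>0 'k::zero) \<noteq> 0"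
  obtains m where "m \<in> Poly_Mapping.keys x"
    "\<forall>w\<in>Poly_Mapping.keys x. w = m \<or> prec w m"
proof -
  have "\<exists>m\<in>S. \<forall>w\<in>S. w = m \<or> prec w m" if "finite S" "S \<noteq> {}" for S
    using that
  proof (induction S rule: finite_ne_induct)
    case (insert a S)
    then obtain m where "m \<in> S" "\<forall>w\<in>S. w = m \<or> prec w m" by blast
    moreover have "prec w a" if "prec m a" "w \<in> S" for w
      using that calculation trans_prec[of w m a] by auto
    ultimately show ?case using total_prec[of a m] by (metis insert_iff)
  qed simp
  moreover obtain w where "Poly_Mapping.lookup x w \<noteq> 0"
    using assms by (metis lookup_zero poly_mapping_eqI)
  then have "Poly_Mapping.keys x \<noteq> {}" by (auto simp: in_keys_iff)
  ultimately obtain m where "m \<in> Poly_Mapping.keys x" "\<forall>w\<in>Poly_Mapping.keys x. w = m \<or> prec w m"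
    by (meson finite_keys)
  then show thesis using that by blast
qed

end

locale unitriangular = well_order_relation prec for prec :: "'w \<Rightarrow> 'w \<Rightarrow> bool" +
  fixes G :: "'w set" and b :: "'w \<Rightarrow> 'w \<Rightarrow>\<^sub>0 'k::comm_ring_1"
  assumes keys_b: "g \<in> G \<Longrightarrow> Poly_Mapping.keys (b g) \<subseteq> {w\<in>G. w = g \<or> prec w g}"
    and lookup_b_self: "g \<in> G \<Longrightarrow> Poly_Mapping.lookup (b g) g = 1"
begin

lemma lookup_b_above: "g \<in> G \<Longrightarrow> prec g w \<Longrightarrow> Poly_Mapping.lookup (b g) w = 0"
  using irrefl_prec trans_prec by (intro lookup_eq_0_outside[OF keys_b]) auto

text \<open>The largest index in a linear combination of a unitriangular family keeps its coefficient, because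
  only the member with that index reaches it.\<close>

lemma lookup_combo_max:
  assumes "Poly_Mapping.keys p \<subseteq> G" "\<And>w. w \<in> Poly_Mapping.keys p \<Longrightarrow> w = m \<or> prec w m" "m \<in> G"
  shows "Poly_Mapping.lookup (combo b p) m = Poly_Mapping.lookup p m"
proof -
  let ?S = "insert m (Poly_Mapping.keys p)"
  have "Poly_Mapping.lookup (combo b p) m =
      (\<Sum>x\<in>?S. Poly_Mapping.lookup p x * Poly_Mapping.lookup (b x) m)"
    by (rule lookup_combo_superset) auto
  also have "\<dots> = (\<Sum>x\<in>?S. if x = m then Poly_Mapping.lookup p m else 0)"
  proof (intro sum.cong refl)
    fix x assume x: "x \<in> ?S"
    show "Poly_Mapping.lookup p x * Poly_Mapping.lookup (b x) m = (if x = m then Poly_Mapping.lookup p m else 0)"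
      using x assms(1,3) assms(2)[of x] lookup_b_above[of x m] lookup_b_self[of m] by (cases "x = m") auto
  qed
  finally show ?thesis by simp
qed

lemma combo_eq_0:
  assumes "Poly_Mapping.keys p \<subseteq> G" "combo b p = 0"
  shows "p = 0"
proof (rule ccontr)
  assume "p \<noteq> 0"
  then obtain m where m: "m \<in> Poly_Mapping.keys p"
    "\<forall>w\<in>Poly_Mapping.keys p. w = m \<or> prec w m"
    by (rule max_key)
  then have "Poly_Mapping.lookup (combo b p) m = Poly_Mapping.lookup p m"
    using assms by (intro lookup_combo_max) auto
  then show False using assms m by (simp add: in_keys_iff)
qed

text \<open>Correction of coefficients from the top. Suppose that each element of \<open>A\<close> can be moved into \<open>N\<close> by
  adding an element of \<open>M\<close>. Then each vector with coefficients in \<open>A\<close> can be moved, by adding a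
  combination of the family with coefficients in \<open>M\<close>, to a vector with coefficients in \<open>N\<close>: the
  multiple of \<open>b h\<close> that corrects the largest coefficient changes only smaller ones besides, and
  these are treated by induction. With \<open>M = UNIV\<close> and \<open>N = {0}\<close> this is the spanning property of the
  family, with \<open>N\<close> the fixed points of an involution it is the existence part of the
  Kazhdan--Lusztig argument.\<close>

lemma combo_correction_upto:
  assumes A: "\<And>x y. x \<in> A \<Longrightarrow> y \<in> A \<Longrightarrow> x + y \<in> A" "\<And>x y. x \<in> A \<Longrightarrow> y \<in> A \<Longrightarrow> x * y \<in> A" "0 \<in> A"
    and b: "\<And>g w. g \<in> G \<Longrightarrow> Poly_Mapping.lookup (b g) w \<in> A"
    and M: "M \<subseteq> A" "0 \<in> M" and N: "0 \<in> N"
    and corr: "\<And>a. a \<in> A \<Longrightarrow> \<exists>t\<in>M. a + t \<in> N"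
    and h: "h \<in> G"
    and x: "Poly_Mapping.keys x \<subseteq> {w\<in>G. w = h \<or> prec w h}" "\<And>w. Poly_Mapping.lookup x w \<in> A"
  shows "\<exists>p. Poly_Mapping.keys p \<subseteq> {w\<in>G. w = h \<or> prec w h} \<and> (\<forall>w. Poly_Mapping.lookup p w \<in> M) \<and>
           (\<forall>w. Poly_Mapping.lookup (x + combo b p) w \<in> N)"
  using h x
proof (induction h arbitrary: x rule: wfp_induct_rule[OF wf_prec])
  case (1 h)
  obtain t where t: "t \<in> M" "Poly_Mapping.lookup x h + t \<in> N" using corr 1(4) by blast
  define a where "a = Poly_Mapping.lookup x h + t"
  \<comment> \<open>What is left to correct: the coefficient at \<open>h\<close> is split off in its final form \<open>a\<close>.\<close>
  define x' where "x' = x + scale t (b h) - Poly_Mapping.single h a"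
  have x'h: "Poly_Mapping.lookup x' h = 0"
    using lookup_b_self[OF 1(2)] by (simp add: x'_def a_def lookup_add lookup_minus)
  have x'w: "Poly_Mapping.lookup x' w = Poly_Mapping.lookup x w + t * Poly_Mapping.lookup (b h) w" if "w \<noteq> h" for w
    using that by (simp add: x'_def lookup_add lookup_minus lookup_single)
  have keys': "Poly_Mapping.keys x' \<subseteq> {w\<in>G. prec w h}"
  proof
    fix w assume "w \<in> Poly_Mapping.keys x'"
    then have "Poly_Mapping.lookup x' w \<noteq> 0" by (simp add: in_keys_iff)
    then have "w \<noteq> h" using x'h by auto
    moreover have "w \<in> Poly_Mapping.keys x \<or> w \<in> Poly_Mapping.keys (b h)"
      using x'w[OF \<open>w \<noteq> h\<close>] \<open>Poly_Mapping.lookup x' w \<noteq> 0\<close> by (auto simp: in_keys_iff)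
    ultimately show "w \<in> {w\<in>G. prec w h}" using 1(3) keys_b[OF 1(2)] by auto
  qed
  have A': "Poly_Mapping.lookup x' w \<in> A" for w
    using A M t x'h x'w[of w] b[OF 1(2)] 1(4) by (cases "w = h") auto
  have "\<exists>p. Poly_Mapping.keys p \<subseteq> {w\<in>G. prec w h} \<and> (\<forall>w. Poly_Mapping.lookup p w \<in> M) \<and>
           (\<forall>w. Poly_Mapping.lookup (x' + combo b p) w \<in> N)"
  proof (cases "x' = 0")
    case True
    then show ?thesis using M N by (intro exI[of _ 0]) simp
  next
    case False
    then obtain m where m: "m \<in> Poly_Mapping.keys x'"
      "\<forall>w\<in>Poly_Mapping.keys x'. w = m \<or> prec w m"
      by (rule max_key)
    then have "m \<in> G" "prec m h" using keys' by auto
    moreover have "Poly_Mapping.keys x' \<subseteq> {w\<in>G. w = m \<or> prec w m}" using m keys' by auto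
    ultimately obtain p where p: "Poly_Mapping.keys p \<subseteq> {w\<in>G. w = m \<or> prec w m}"
      "\<forall>w. Poly_Mapping.lookup p w \<in> M" "\<forall>w. Poly_Mapping.lookup (x' + combo b p) w \<in> N"
      using 1(1)[of m x'] A' by blast
    moreover have "Poly_Mapping.keys p \<subseteq> {w\<in>G. prec w h}" using p(1) \<open>prec m h\<close> trans_prec by blast
    ultimately show ?thesis by blast
  qed
  then obtain p where p: "Poly_Mapping.keys p \<subseteq> {w\<in>G. prec w h}"
    "\<forall>w. Poly_Mapping.lookup p w \<in> M" "\<forall>w. Poly_Mapping.lookup (x' + combo b p) w \<in> N" by blast
  define p' where "p' = Poly_Mapping.single h t + p"
  \<comment> \<open>The later corrections stay below \<open>h\<close>, so the coefficient at \<open>h\<close> remains final.\<close>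
  have ph: "Poly_Mapping.lookup p h = 0" using p(1) irrefl_prec[of h] by (auto simp: in_keys_iff)
  have "Poly_Mapping.keys p' \<subseteq> {w\<in>G. w = h \<or> prec w h}"
    using p(1) 1(2) Poly_Mapping.keys_add[of "Poly_Mapping.single h t" p] unfolding p'_def
    by (auto split: if_splits)
  moreover have "Poly_Mapping.lookup p' w \<in> M" for w
    using ph t p(2) by (cases "w = h") (auto simp: p'_def lookup_add lookup_single)
  moreover have "Poly_Mapping.lookup (x + combo b p') w \<in> N" for w
  proof -
    have eq: "x + combo b p' = Poly_Mapping.single h a + (x' + combo b p)"
      by (simp add: p'_def x'_def combo_add algebra_simps)
    have "Poly_Mapping.lookup (combo b p) h = 0"
      using lookup_combo_max[of p h] p(1) ph 1(2) by auto
    then show ?thesis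
      using t p(3) x'h unfolding eq by (cases "w = h") (auto simp: lookup_add lookup_single a_def)
  qed
  ultimately show ?case by blast
qed

lemma combo_correction:
  assumes A: "\<And>x y. x \<in> A \<Longrightarrow> y \<in> A \<Longrightarrow> x + y \<in> A" "\<And>x y. x \<in> A \<Longrightarrow> y \<in> A \<Longrightarrow> x * y \<in> A" "0 \<in> A"
    and b: "\<And>g w. g \<in> G \<Longrightarrow> Poly_Mapping.lookup (b g) w \<in> A"
    and M: "M \<subseteq> A" "0 \<in> M" and N: "0 \<in> N"
    and corr: "\<And>a. a \<in> A \<Longrightarrow> \<exists>t\<in>M. a + t \<in> N"
    and S: "S \<subseteq> G" "\<And>v w. w \<in> S \<Longrightarrow> v \<in> G \<Longrightarrow> prec v w \<Longrightarrow> v \<in> S"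
    and x: "Poly_Mapping.keys x \<subseteq> S" "\<And>w. Poly_Mapping.lookup x w \<in> A"
  obtains p where "Poly_Mapping.keys p \<subseteq> S" "\<And>w. Poly_Mapping.lookup p w \<in> M"
    "\<And>w. Poly_Mapping.lookup (x + combo b p) w \<in> N"
proof (cases "x = 0")
  case True
  then show thesis using that[of 0] M N by simp
next
  case False
  then obtain m where m: "m \<in> Poly_Mapping.keys x"
    "\<forall>w\<in>Poly_Mapping.keys x. w = m \<or> prec w m"
    by (rule max_key)
  have keys: "m \<in> G" "Poly_Mapping.keys x \<subseteq> {w\<in>G. w = m \<or> prec w m}" using m S x(1) by blast+
  have "\<exists>p. Poly_Mapping.keys p \<subseteq> {w\<in>G. w = m \<or> prec w m} \<and> (\<forall>w. Poly_Mapping.lookup p w \<in> M) \<and>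
           (\<forall>w. Poly_Mapping.lookup (x + combo b p) w \<in> N)"
    by (rule combo_correction_upto[OF A b M N corr keys x(2)])
  then obtain p where p: "Poly_Mapping.keys p \<subseteq> {w\<in>G. w = m \<or> prec w m}"
    "\<forall>w. Poly_Mapping.lookup p w \<in> M" "\<forall>w. Poly_Mapping.lookup (x + combo b p) w \<in> N"
    by blast
  moreover have "{w\<in>G. w = m \<or> prec w m} \<subseteq> S" using S m x(1) by blast
  ultimately show thesis using that by blast
qed

lemma unitriangular_basis:
  assumes "Poly_Mapping.keys x \<subseteq> G"
  shows "\<exists>!p. Poly_Mapping.keys p \<subseteq> G \<and> x = combo b p"
proof -
  obtain p where p: "Poly_Mapping.keys p \<subseteq> G" "\<And>w. Poly_Mapping.lookup (x + combo b p) w \<in> {0}"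
  proof (rule combo_correction[of UNIV UNIV "{0}" G x])
    show "\<exists>t\<in>UNIV. a + t \<in> {0}" for a :: 'k by (rule bexI[of _ "- a"]) auto
  qed (use assms in auto)
  then have "x + combo b p = 0" by (intro poly_mapping_eqI) simp
  then have "x = combo b (- p)" by (simp add: combo_uminus eq_neg_iff_add_eq_0)
  moreover have "Poly_Mapping.keys (- p) \<subseteq> G" using p(1) by (auto simp: in_keys_iff)
  moreover have "p = q" if "Poly_Mapping.keys p \<subseteq> G" "Poly_Mapping.keys q \<subseteq> G" "combo b p = combo b q" for p q
  proof -
    have "Poly_Mapping.keys (p - q) \<subseteq> G" using that by (intro keys_diff_subset)
    with combo_eq_0[of "p - q"] that(3) show ?thesis by (simp add: combo_diff)
  qed
  ultimately show ?thesis by metis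
qed

text \<open>The coefficient of \<open>b g\<close> at \<open>g\<close> itself is \<open>1\<close>, hence already invariant; only the part below \<open>g\<close>
  has to be corrected.\<close>

lemma bar_invariant_correction_exists:
  assumes A: "\<And>x y. x \<in> A \<Longrightarrow> y \<in> A \<Longrightarrow> x + y \<in> A" "\<And>x y. x \<in> A \<Longrightarrow> y \<in> A \<Longrightarrow> x * y \<in> A" "0 \<in> A"
    and b: "\<And>g w. g \<in> G \<Longrightarrow> Poly_Mapping.lookup (b g) w \<in> A"
    and M: "M \<subseteq> A" "0 \<in> M"
    and \<sigma>: "\<sigma> 0 = 0" "\<sigma> 1 = 1"
    and corr: "\<And>a. a \<in> A \<Longrightarrow> \<exists>t\<in>M. \<sigma> (a + t) = a + t"
    and g: "g \<in> G"
  obtains p where "Poly_Mapping.keys p \<subseteq> {w\<in>G. prec w g}" "\<And>w. Poly_Mapping.lookup p w \<in> M"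
    "\<And>w. \<sigma> (Poly_Mapping.lookup (b g + combo b p) w) = Poly_Mapping.lookup (b g + combo b p) w"
proof -
  define x where "x = b g - Poly_Mapping.single g 1"
  have lx: "Poly_Mapping.lookup x w = (if w = g then 0 else Poly_Mapping.lookup (b g) w)" for w
    using lookup_b_self[OF g] by (simp add: x_def lookup_minus lookup_single when_def)
  have keys: "Poly_Mapping.keys x \<subseteq> {w\<in>G. prec w g}"
    using keys_b[OF g] by (auto simp: in_keys_iff lx split: if_splits)
  obtain p where p: "Poly_Mapping.keys p \<subseteq> {w\<in>G. prec w g}" "\<And>w. Poly_Mapping.lookup p w \<in> M"
    "\<And>w. Poly_Mapping.lookup (x + combo b p) w \<in> {a. \<sigma> a = a}"
  proof (rule combo_correction[of A M "{a. \<sigma> a = a}" "{w\<in>G. prec w g}" x])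
    show "\<exists>t\<in>M. a + t \<in> {a. \<sigma> a = a}" if "a \<in> A" for a using corr[OF that] by simp
  qed (use A b M \<sigma> keys lx g trans_prec in auto)
  have "\<sigma> (Poly_Mapping.lookup (b g + combo b p) w) = Poly_Mapping.lookup (b g + combo b p) w" for w
  proof (cases "w = g")
    case True
    have "Poly_Mapping.lookup (combo b p) g = 0"
      using lookup_combo_max[of p g] p(1) g irrefl_prec[of g] lookup_eq_0_outside[OF p(1), of g] by auto
    then show ?thesis using True lookup_b_self[OF g] \<sigma> by (simp add: lookup_add)
  next
    case False
    then show ?thesis using p(3)[of w] by (simp add: lookup_add lx)
  qed
  with p that show thesis by blast
qed

text \<open>The largest coefficient of the difference of two invariant corrections is an invariant element
  of \<open>M\<close>.\<close>

lemma bar_invariant_correction_unique: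
  assumes M: "\<And>x y. x \<in> M \<Longrightarrow> y \<in> M \<Longrightarrow> x - y \<in> M"
    and \<sigma>: "\<And>x y. \<sigma> (x - y) = \<sigma> x - \<sigma> y" "\<And>a. a \<in> M \<Longrightarrow> \<sigma> a = a \<Longrightarrow> a = 0"
    and p: "Poly_Mapping.keys p \<subseteq> G" "\<And>w. Poly_Mapping.lookup p w \<in> M"
      "\<And>w. \<sigma> (Poly_Mapping.lookup (x + combo b p) w) = Poly_Mapping.lookup (x + combo b p) w"
    and p': "Poly_Mapping.keys p' \<subseteq> G" "\<And>w. Poly_Mapping.lookup p' w \<in> M"
      "\<And>w. \<sigma> (Poly_Mapping.lookup (x + combo b p') w) = Poly_Mapping.lookup (x + combo b p') w"
  shows "p = p'"
proof (rule ccontr)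
  assume "p \<noteq> p'"
  then have "p - p' \<noteq> 0" by simp
  then obtain m where m: "m \<in> Poly_Mapping.keys (p - p')"
    "\<forall>w\<in>Poly_Mapping.keys (p - p'). w = m \<or> prec w m"
    by (rule max_key)
  have keys: "Poly_Mapping.keys (p - p') \<subseteq> G" using p(1) p'(1) by (rule keys_diff_subset)
  have "combo b (p - p') = (x + combo b p) - (x + combo b p')" by (simp add: combo_diff)
  then have "\<sigma> (Poly_Mapping.lookup (combo b (p - p')) m) = Poly_Mapping.lookup (combo b (p - p')) m"
    using p(3)[of m] p'(3)[of m] by (simp only: lookup_minus \<sigma>(1))
  moreover have "Poly_Mapping.lookup (combo b (p - p')) m = Poly_Mapping.lookup (p - p') m"
    using keys m by (intro lookup_combo_max) auto
  ultimately have "Poly_Mapping.lookup (p - p') m = 0"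
    using M[OF p(2) p'(2), of m m] \<sigma>(2) by (simp only: lookup_minus)
  with m show False by (simp add: in_keys_iff)
qed

end


section \<open>Integral Laurent polynomials and the inversion of q\<close>

lemma qq_nonzero [simp]: "qq \<noteq> 0"
  by (simp add: qq_def Zero_fract_def eq_fract)

abbreviation eval_int :: "int poly \<Rightarrow> qfield \<Rightarrow> qfield" where
  "eval_int p x \<equiv> poly (map_poly of_int p) x"

lemma eval_int_pCons: "eval_int (pCons a p) x = of_int a + x * eval_int p x"
  by (simp add: map_poly_pCons)

lemma eval_int_add: "eval_int (p + q) x = eval_int p x + eval_int q x"
proof -
  have "map_poly of_int (p + q) = (map_poly of_int p + map_poly of_int q :: qfield poly)"
    by (rule poly_eqI) (simp add: coeff_map_poly)
  then show ?thesis by simp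
qed

lemma eval_int_diff: "eval_int (p - q) x = eval_int p x - eval_int q x"
  using eval_int_add[of "p - q" q x] by simp

lemma eval_int_smult: "eval_int (Polynomial.smult a p) x = of_int a * eval_int p x"
  by (simp add: map_poly_smult)

lemma eval_int_mult: "eval_int (p * q) x = eval_int p x * eval_int q x"
  by (induction p) (simp_all add: eval_int_pCons eval_int_add eval_int_smult algebra_simps)

lemma eval_int_monom: "eval_int (Polynomial.monom a n) x = of_int a * x ^ n"
  by (simp add: map_poly_monom poly_monom)

lemma of_rat_qfield: "(of_rat r :: qfield) = Fract [:r:] 1"
proof (cases r)
  case (Fract a b)
  have of_int_Fract: "(of_int z :: qfield) = Fract (of_int z) 1" for z
    by (cases z rule: int_diff_cases) (simp add: of_nat_fract)
  show ?thesis
    using Fract by (simp add: Fract_of_int_quotient of_rat_divide of_int_Fract of_int_poly eq_fract)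
qed

text \<open>Evaluation at the indeterminate is the embedding of the polynomials into their fraction field, so
  that identities between values at \<^const>\<open>qq\<close> are identities of polynomials.\<close>

lemma eval_rat_qq: "poly (map_poly of_rat p) qq = Fract p 1"
  by (induction p) (simp_all add: map_poly_pCons of_rat_qfield qq_def fract_collapse)

lemma eval_int_qq: "eval_int p qq = Fract (map_poly of_int p) 1"
  using eval_rat_qq[of "map_poly of_int p"] by (simp add: map_poly_map_poly comp_def)

lemma eval_int_qq_eq_iff: "eval_int p qq = eval_int r qq \<longleftrightarrow> p = r"
proof
  assume "eval_int p qq = eval_int r qq"
  then have "(map_poly of_int p :: rat poly) = map_poly of_int r" by (simp add: eval_int_qq eq_fract)
  then have "(of_int (Polynomial.coeff p n) :: rat) = of_int (Polynomial.coeff r n)" for n by (metis coeff_map_poly of_int_0)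
  then show "p = r" by (intro poly_eqI) simp
qed simp

lemma int_qpolys_iff: "x \<in> int_qpolys \<longleftrightarrow> (\<exists>p. x = eval_int p qq)"
  by (auto simp: int_qpolys_def)

lemma int_laurent_iff: "x \<in> int_laurent \<longleftrightarrow> (\<exists>p m. x = eval_int p qq / qq ^ m)"
  by (auto simp: int_laurent_def int_qpolys_iff power_int_minus divide_inverse)

lemma int_laurent_mult: "x \<in> int_laurent \<Longrightarrow> y \<in> int_laurent \<Longrightarrow> x * y \<in> int_laurent"
  unfolding int_laurent_iff
proof (elim exE)
  fix p m r n assume "x = eval_int p qq / qq ^ m" "y = eval_int r qq / qq ^ n"
  then have "x * y = eval_int (p * r) qq / qq ^ (m + n)"
    by (simp add: eval_int_mult power_add)
  then show "\<exists>p m. x * y = eval_int p qq / qq ^ m" by blast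
qed

lemma int_laurent_add: "x \<in> int_laurent \<Longrightarrow> y \<in> int_laurent \<Longrightarrow> x + y \<in> int_laurent"
  unfolding int_laurent_iff
proof (elim exE)
  fix p m r n assume "x = eval_int p qq / qq ^ m" "y = eval_int r qq / qq ^ n"
  moreover have "eval_int p qq / qq ^ m + eval_int r qq / qq ^ n =
      eval_int (p * Polynomial.monom 1 n + r * Polynomial.monom 1 m) qq / qq ^ (m + n)"
    by (simp add: eval_int_mult eval_int_add eval_int_monom power_add field_simps)
  ultimately have "x + y = eval_int (p * Polynomial.monom 1 n + r * Polynomial.monom 1 m) qq / qq ^ (m + n)"
    by simp
  then show "\<exists>p m. x + y = eval_int p qq / qq ^ m" by blast
qed

lemma int_laurent_of_int: "of_int n \<in> int_laurent"
  unfolding int_laurent_iff by (intro exI[of _ "[:n:]"] exI[of _ 0]) (simp add: eval_int_pCons)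

lemma int_laurent_0: "0 \<in> int_laurent" and int_laurent_1: "1 \<in> int_laurent"
  using int_laurent_of_int[of 0] int_laurent_of_int[of 1] by simp_all

lemma int_laurent_uminus: "x \<in> int_laurent \<Longrightarrow> - x \<in> int_laurent"
  using int_laurent_mult[OF int_laurent_of_int[of "-1"]] by simp

lemma int_laurent_sum: "(\<And>i. i \<in> S \<Longrightarrow> f i \<in> int_laurent) \<Longrightarrow> sum f S \<in> int_laurent"
  by (induction S rule: infinite_finite_induct) (auto intro: int_laurent_0 int_laurent_add)

lemma int_laurent_powi: "qq powi k \<in> int_laurent"
proof (cases "k \<ge> 0")
  case True
  then show ?thesis unfolding int_laurent_iff
    by (intro exI[of _ "Polynomial.monom 1 (nat k)"] exI[of _ 0]) (simp add: eval_int_monom power_int_def)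
next
  case False
  then show ?thesis unfolding int_laurent_iff
    by (intro exI[of _ 1] exI[of _ "nat (- k)"]) (simp add: power_int_def field_simps)
qed

lemma q_int_qpolys_iff: "x \<in> q_int_qpolys \<longleftrightarrow> (\<exists>p. x = eval_int (pCons 0 p) qq)"
  by (auto simp: q_int_qpolys_def int_qpolys_iff eval_int_pCons)

lemma q_int_qpolys_subset_int_laurent: "q_int_qpolys \<subseteq> int_laurent"
proof
  fix x assume "x \<in> q_int_qpolys"
  then obtain p where "x = eval_int (pCons 0 p) qq / qq ^ 0" by (auto simp: q_int_qpolys_iff)
  then show "x \<in> int_laurent" unfolding int_laurent_iff by blast
qed

lemma q_int_qpolys_add: "x \<in> q_int_qpolys \<Longrightarrow> y \<in> q_int_qpolys \<Longrightarrow> x + y \<in> q_int_qpolys"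
  unfolding q_int_qpolys_iff by (auto simp: eval_int_add[symmetric] simp del: eval_int_pCons)

lemma q_int_qpolys_monom: "n > 0 \<Longrightarrow> of_int a * qq ^ n \<in> q_int_qpolys"
  unfolding q_int_qpolys_iff
  by (intro exI[of _ "Polynomial.monom a (n - 1)"]) (cases n, simp_all add: eval_int_pCons eval_int_monom)

lemma q_int_qpolys_0: "0 \<in> q_int_qpolys"
  using q_int_qpolys_monom[of 1 0] by simp

lemma q_int_qpolys_diff: "x \<in> q_int_qpolys \<Longrightarrow> y \<in> q_int_qpolys \<Longrightarrow> x - y \<in> q_int_qpolys"
  unfolding q_int_qpolys_iff
proof (elim exE)
  fix p r assume "x = eval_int (pCons 0 p) qq" "y = eval_int (pCons 0 r) qq"
  then have "x - y = eval_int (pCons 0 (p - r)) qq"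
    by (simp add: eval_int_pCons eval_int_diff algebra_simps)
  then show "\<exists>p. x - y = eval_int (pCons 0 p) qq" by blast
qed

text \<open>The bar involution acts in this way on the scalars of the subalgebra.\<close>

locale q_inversion =
  fixes \<sigma> :: "qfield \<Rightarrow> qfield"
  assumes \<sigma>_add: "\<sigma> (x + y) = \<sigma> x + \<sigma> y"
    and \<sigma>_mult: "\<sigma> (x * y) = \<sigma> x * \<sigma> y"
    and \<sigma>_1: "\<sigma> 1 = 1"
    and \<sigma>_qq: "\<sigma> qq = inverse qq"
begin

lemma \<sigma>_0: "\<sigma> 0 = 0"
  using \<sigma>_add[of 0 0] by simp

lemma \<sigma>_uminus: "\<sigma> (- x) = - \<sigma> x"
  using \<sigma>_add[of x "- x"] by (simp add: \<sigma>_0 eq_neg_iff_add_eq_0 add.commute)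

lemma \<sigma>_diff: "\<sigma> (x - y) = \<sigma> x - \<sigma> y"
  using \<sigma>_add[of x "- y"] by (simp add: \<sigma>_uminus)

lemma \<sigma>_of_int: "\<sigma> (of_int n) = of_int n"
proof -
  have "\<sigma> (of_nat k) = of_nat k" for k by (induction k) (simp_all add: \<sigma>_0 \<sigma>_1 \<sigma>_add)
  then show ?thesis by (cases n rule: int_diff_cases) (simp add: \<sigma>_diff)
qed

lemma \<sigma>_power: "\<sigma> (x ^ n) = \<sigma> x ^ n"
  by (induction n) (simp_all add: \<sigma>_1 \<sigma>_mult)

lemma \<sigma>_inverse_qq: "\<sigma> (inverse qq) = qq"
  using \<sigma>_mult[of qq "inverse qq"] by (simp add: \<sigma>_1 \<sigma>_qq field_simps)

lemma \<sigma>_eval_int: "\<sigma> (eval_int p qq) = eval_int p (inverse qq)"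
  by (induction p) (simp_all add: eval_int_pCons \<sigma>_0 \<sigma>_add \<sigma>_mult \<sigma>_of_int \<sigma>_qq)

text \<open>If \<open>r(q) = r(q\<^sup>-\<^sup>1)\<close>, then \<open>q\<^sup>n r(q)\<close>, with \<open>n\<close> the degree of \<open>r\<close>, is the value at \<open>q\<close> of the
  reflected polynomial. The constant coefficient of the latter is the leading coefficient of \<open>r\<close>,
  whereas that of \<open>x\<^sup>n r\<close> vanishes as soon as \<open>r\<close> has no constant term.\<close>

lemma fixed_q_int_qpolys_eq_0:
  assumes "a \<in> q_int_qpolys" "\<sigma> a = a"
  shows "a = 0"
proof -
  obtain p where a: "a = eval_int (pCons 0 p) qq" using assms(1) by (auto simp: q_int_qpolys_iff)
  define r where "r = pCons 0 p"
  have deg: "Polynomial.degree (map_poly of_int r :: qfield poly) = Polynomial.degree r" by (rule degree_map_poly) simp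
  then have refl: "reflect_poly (map_poly of_int r) = (map_poly of_int (reflect_poly r) :: qfield poly)"
    by (intro poly_eqI) (simp add: coeff_reflect_poly coeff_map_poly)
  have "eval_int (reflect_poly r) qq = qq ^ Polynomial.degree r * eval_int r (inverse qq)"
    using poly_reflect_poly_nz[OF qq_nonzero, of "map_poly of_int r"] deg refl by simp
  also have "\<dots> = qq ^ Polynomial.degree r * eval_int r qq"
    using assms(2) a by (simp add: r_def \<sigma>_eval_int)
  also have "\<dots> = eval_int (Polynomial.monom 1 (Polynomial.degree r) * r) qq"
    by (simp add: eval_int_mult eval_int_monom)
  finally have "reflect_poly r = Polynomial.monom 1 (Polynomial.degree r) * r" by (simp add: eval_int_qq_eq_iff)
  then have "Polynomial.lead_coeff r = Polynomial.coeff (Polynomial.monom 1 (Polynomial.degree r) * r) 0" by (metis coeff_0_reflect_poly)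
  also have "\<dots> = 0" by (simp add: coeff_mult r_def)
  finally have "r = 0" by (simp only: leading_coeff_0_iff)
  then show ?thesis using a by (simp add: r_def)
qed

text \<open>It suffices to correct monomials: nothing is added to a constant, a positive power of \<open>q\<close> is
  cancelled, and \<open>q\<^sup>-\<^sup>k\<close> is completed to \<open>q\<^sup>-\<^sup>k + q\<^sup>k\<close>.\<close>

lemma int_laurent_correction:
  assumes "a \<in> int_laurent"
  shows "\<exists>t\<in>q_int_qpolys. \<sigma> (a + t) = a + t"
proof -
  obtain p m where a: "a = eval_int p qq / qq ^ m" using assms by (auto simp: int_laurent_iff)
  have monom: "\<exists>t\<in>q_int_qpolys. \<sigma> (of_int n * qq ^ i / qq ^ m + t) = of_int n * qq ^ i / qq ^ m + t" for n i
  proof -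
    consider "i = m" | "i > m" | "i < m" by linarith
    then show ?thesis
    proof cases
      case 1
      then show ?thesis by (intro bexI[of _ 0]) (simp_all add: \<sigma>_of_int q_int_qpolys_0)
    next
      case 2
      then have "of_int n * qq ^ i / qq ^ m = of_int n * qq ^ (i - m)" by (simp add: power_diff)
      then show ?thesis using 2 q_int_qpolys_monom[of "i - m" "- n"]
        by (intro bexI[of _ "of_int (- n) * qq ^ (i - m)"]) (simp_all add: \<sigma>_0)
    next
      case 3
      then have "of_int n * qq ^ i / qq ^ m = of_int n * inverse qq ^ (m - i)"
        by (simp add: power_diff field_simps)
      then show ?thesis using 3 q_int_qpolys_monom[of "m - i" n]
        by (intro bexI[of _ "of_int n * qq ^ (m - i)"])
           (simp_all add: \<sigma>_add \<sigma>_mult \<sigma>_of_int \<sigma>_power \<sigma>_qq \<sigma>_inverse_qq)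
    qed
  qed
  have "\<exists>t\<in>q_int_qpolys. \<sigma> ((\<Sum>i\<in>S. of_int (Polynomial.coeff p i) * qq ^ i / qq ^ m) + t)
      = (\<Sum>i\<in>S. of_int (Polynomial.coeff p i) * qq ^ i / qq ^ m) + t" if "finite S" for S
    using that
  proof (induction S)
    case empty
    then show ?case by (intro bexI[of _ 0]) (simp_all add: \<sigma>_0 q_int_qpolys_0)
  next
    case (insert j S)
    let ?f = "\<lambda>i. of_int (Polynomial.coeff p i) * qq ^ i / qq ^ m"
    obtain t where t: "t \<in> q_int_qpolys" "\<sigma> (sum ?f S + t) = sum ?f S + t" using insert by auto
    obtain u where u: "u \<in> q_int_qpolys" "\<sigma> (?f j + u) = ?f j + u" using monom by blast
    have "sum ?f (insert j S) + (u + t) = (?f j + u) + (sum ?f S + t)" using insert by simp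
    moreover have "\<sigma> ((?f j + u) + (sum ?f S + t)) = (?f j + u) + (sum ?f S + t)"
      by (simp only: \<sigma>_add[of "?f j + u"] t(2) u(2))
    ultimately have "\<sigma> (sum ?f (insert j S) + (u + t)) = sum ?f (insert j S) + (u + t)"
      by (simp only:)
    then show ?case using t u q_int_qpolys_add by blast
  qed
  moreover have "a = (\<Sum>i\<le>Polynomial.degree p. of_int (Polynomial.coeff p i) * qq ^ i / qq ^ m)"
    unfolding a by (simp add: poly_altdef degree_map_poly coeff_map_poly sum_divide_distrib)
  ultimately show ?thesis by auto
qed

end


section \<open>Leading words of bracketings\<close>

lemma scalar_mult_conv_scale: "scalar c * x = scale c x"
  unfolding scalar_def scale_def by (simp add: mult_map_scale_conv_mult zero_list_def)

lemma word_elt_Nil: "word_elt [] = 1"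
  by (simp add: word_elt_def flip: zero_list_def)

lemma scale_word_elt: "scale c (word_elt w) = Poly_Mapping.single w c"
  by (rule poly_mapping_eqI) (simp add: word_elt_def lookup_single when_def)

lemma poly_mapping_sum_single: "(\<Sum>w\<in>Poly_Mapping.keys x. Poly_Mapping.single w (Poly_Mapping.lookup x w)) = x"
proof (rule poly_mapping_eqI)
  fix w
  have "Poly_Mapping.lookup (\<Sum>w\<in>Poly_Mapping.keys x. Poly_Mapping.single w (Poly_Mapping.lookup x w)) w
      = (\<Sum>v\<in>Poly_Mapping.keys x. if v = w then Poly_Mapping.lookup x w else 0)"
    by (auto simp: lookup_sum lookup_single when_def intro!: sum.cong)
  then show "Poly_Mapping.lookup (\<Sum>w\<in>Poly_Mapping.keys x. Poly_Mapping.single w (Poly_Mapping.lookup x w)) w =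
      Poly_Mapping.lookup x w"
    by (simp add: in_keys_iff)
qed

lemma free_alg_mult_expand:
  "x * y = (\<Sum>u\<in>Poly_Mapping.keys x. \<Sum>v\<in>Poly_Mapping.keys y.
     scale (Poly_Mapping.lookup x u * Poly_Mapping.lookup y v) (word_elt (u @ v)))"
proof -
  have "x * y = (\<Sum>w\<in>Poly_Mapping.keys x. Poly_Mapping.single w (Poly_Mapping.lookup x w)) *
      (\<Sum>w\<in>Poly_Mapping.keys y. Poly_Mapping.single w (Poly_Mapping.lookup y w))"
    by (simp add: poly_mapping_sum_single)
  then show ?thesis by (simp add: sum_product mult_single scale_word_elt plus_list_def)
qed

text \<open>The vectors that may follow a leading word \<open>w\<close>: integral Laurent combinations of
  lexicographically larger words of the same length. Keeping the length fixed makes the comparison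
  compatible with concatenation, as no word involved is a proper prefix of another.\<close>

definition laurent_above :: "'i::linorder list \<Rightarrow> 'i free_alg set" where
  "laurent_above w = {x. (\<forall>z\<in>Poly_Mapping.keys x. length z = length w \<and> word_less w z) \<and>
     (\<forall>z. Poly_Mapping.lookup x z \<in> int_laurent)}"

definition leads :: "'i::linorder list \<Rightarrow> 'i free_alg \<Rightarrow> bool" where
  "leads w x \<longleftrightarrow> x - word_elt w \<in> laurent_above w"

lemma laurent_above_0: "0 \<in> laurent_above w"
  by (simp add: laurent_above_def int_laurent_0)

lemma laurent_above_add: "x \<in> laurent_above w \<Longrightarrow> y \<in> laurent_above w \<Longrightarrow> x + y \<in> laurent_above w"
  using Poly_Mapping.keys_add[of x y]
  by (auto simp: laurent_above_def lookup_add int_laurent_add)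

lemma laurent_above_scale: "a \<in> int_laurent \<Longrightarrow> x \<in> laurent_above w \<Longrightarrow> scale a x \<in> laurent_above w"
  by (auto simp: laurent_above_def in_keys_iff int_laurent_mult)

lemma laurent_above_uminus: "x \<in> laurent_above w \<Longrightarrow> - x \<in> laurent_above w"
  by (auto simp: laurent_above_def in_keys_iff int_laurent_uminus)

lemma laurent_above_diff: "x \<in> laurent_above w \<Longrightarrow> y \<in> laurent_above w \<Longrightarrow> x - y \<in> laurent_above w"
  using laurent_above_add[OF _ laurent_above_uminus, of x w y] by simp

lemma laurent_above_sum: "(\<And>i. i \<in> S \<Longrightarrow> f i \<in> laurent_above w) \<Longrightarrow> sum f S \<in> laurent_above w"
  by (induction S rule: infinite_finite_induct) (auto intro: laurent_above_0 laurent_above_add)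

lemma laurent_above_word_elt:
  "length z = length w \<Longrightarrow> word_less w z \<Longrightarrow> word_elt z \<in> laurent_above w"
  by (auto simp: laurent_above_def word_elt_def lookup_single when_def int_laurent_0 int_laurent_1)

lemma leads_word_elt: "leads w (word_elt w)"
  by (simp add: leads_def laurent_above_0)

lemma leads_keys:
  assumes "leads w x" "z \<in> Poly_Mapping.keys x"
  shows "length z = length w" "z = w \<or> word_less w z"
proof -
  have "z = w \<or> z \<in> Poly_Mapping.keys (x - word_elt w)"
    using assms(2) by (auto simp: in_keys_iff lookup_minus word_elt_def lookup_single)
  then show "length z = length w" "z = w \<or> word_less w z"
    using assms(1) by (auto simp: leads_def laurent_above_def)
qed

lemma leads_lookup:
  assumes "leads w x"
  shows "Poly_Mapping.lookup x w = 1" "Poly_Mapping.lookup x z \<in> int_laurent"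
proof -
  have "w \<notin> Poly_Mapping.keys (x - word_elt w)"
    using assms by (auto simp: leads_def laurent_above_def)
  then show 1: "Poly_Mapping.lookup x w = 1" by (simp add: in_keys_iff lookup_minus word_elt_def)
  have "Poly_Mapping.lookup (x - word_elt w) z \<in> int_laurent"
    using assms by (simp add: leads_def laurent_above_def)
  then show "Poly_Mapping.lookup x z \<in> int_laurent"
    using 1 by (cases "z = w") (auto simp: lookup_minus word_elt_def lookup_single int_laurent_1)
qed

text \<open>Products and brackets are both bilinear extensions of an operation \<open>T\<close> on words. Such an extension
  has leading word \<open>u @ v\<close> if \<open>T u v\<close> has, and if \<open>T\<close> takes all other pairs of occurring words to
  larger ones.\<close>

lemma leads_bilinear:
  assumes x: "leads u x" and y: "leads v y"
    and T: "leads (u @ v) (T u v)"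
      "\<And>a b. length a = length u \<Longrightarrow> length b = length v \<Longrightarrow> a = u \<or> word_less u a \<Longrightarrow> b = v \<or> word_less v b \<Longrightarrow>
        (a, b) \<noteq> (u, v) \<Longrightarrow> T a b \<in> laurent_above (u @ v)"
  shows "leads (u @ v) (\<Sum>a\<in>Poly_Mapping.keys x. \<Sum>b\<in>Poly_Mapping.keys y.
    scale (Poly_Mapping.lookup x a * Poly_Mapping.lookup y b) (T a b))"
proof -
  let ?K = "Poly_Mapping.keys x \<times> Poly_Mapping.keys y"
  let ?f = "\<lambda>(a, b). scale (Poly_Mapping.lookup x a * Poly_Mapping.lookup y b) (T a b)"
  have uv: "(u, v) \<in> ?K" using leads_lookup(1)[OF x] leads_lookup(1)[OF y] by (simp add: in_keys_iff)
  have fuv: "?f (u, v) = T u v"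
    by (rule poly_mapping_eqI) (simp add: leads_lookup(1)[OF x] leads_lookup(1)[OF y])
  have "?f p \<in> laurent_above (u @ v)" if "p \<in> ?K - {(u, v)}" for p
  proof -
    obtain a b where p: "p = (a, b)" by (cases p)
    with that have "a \<in> Poly_Mapping.keys x" "b \<in> Poly_Mapping.keys y" "(a, b) \<noteq> (u, v)" by auto
    then have "T a b \<in> laurent_above (u @ v)"
      using leads_keys[OF x] leads_keys[OF y] by (intro T(2)) auto
    then show ?thesis
      unfolding p using leads_lookup(2)[OF x] leads_lookup(2)[OF y]
      by (auto intro!: laurent_above_scale int_laurent_mult)
  qed
  then have rest: "sum ?f (?K - {(u, v)}) \<in> laurent_above (u @ v)" by (rule laurent_above_sum)
  have "sum ?f ?K - word_elt (u @ v) = (T u v - word_elt (u @ v)) + sum ?f (?K - {(u, v)})"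
    using sum.remove[OF _ uv, of ?f] fuv by simp
  also have "\<dots> \<in> laurent_above (u @ v)" using T(1) rest unfolding leads_def by (rule laurent_above_add)
  finally show ?thesis by (simp add: leads_def sum.cartesian_product)
qed

lemma word_less_append_mono:
  assumes "length a = length u" "a = u \<or> word_less u a" "b = v \<or> word_less v b" "(a, b) \<noteq> (u, v)"
  shows "word_less (u @ v) (a @ b)"
  using assms by (cases "a = u") (auto intro: word_less_append)

lemma leads_mult:
  assumes "leads u x" "leads v y"
  shows "leads (u @ v) (x * y)"
  unfolding free_alg_mult_expand
  by (rule leads_bilinear[OF assms, of "\<lambda>a b. word_elt (a @ b)"])
     (auto intro!: leads_word_elt laurent_above_word_elt word_less_append_mono)

text \<open>The flipped words \<open>b @ a\<close> are at least \<open>v @ u\<close>, which exceeds \<open>u @ v\<close> because \<open>u @ v\<close> is Lyndon; so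
  the second half of the bracket contributes only larger words.\<close>

lemma leads_qbracket:
  assumes x: "leads u x" and y: "leads v y" and uv: "lyndon (u @ v)" "u \<noteq> []" "v \<noteq> []"
  shows "leads (u @ v) (qbracket \<alpha> x y)"
proof -
  let ?c = "\<lambda>a b. qq powi (- lattice_form (word_weight \<alpha> a) (word_weight \<alpha> b))"
  define T where "T a b = word_elt (a @ b) - scale (?c a b) (word_elt (b @ a))" for a b
  have flipped: "scale (?c a b) (word_elt (b @ a)) \<in> laurent_above (u @ v)"
    if "length a = length u" "length b = length v" "a = u \<or> word_less u a" "b = v \<or> word_less v b" for a b
  proof -
    have "word_less (u @ v) (v @ u)" using lyndon_append_less[OF uv, of "[]" u] by simp
    moreover have "(b, a) = (v, u) \<or> word_less (v @ u) (b @ a)"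
      using word_less_append_mono[of b v a u] that by auto
    ultimately have "word_less (u @ v) (b @ a)" by (auto intro: word_less_trans)
    then show ?thesis using that by (intro laurent_above_scale int_laurent_powi laurent_above_word_elt) auto
  qed
  have "leads (u @ v) (\<Sum>a\<in>Poly_Mapping.keys x. \<Sum>b\<in>Poly_Mapping.keys y.
    scale (Poly_Mapping.lookup x a * Poly_Mapping.lookup y b) (T a b))"
  proof (rule leads_bilinear[OF x y])
    show "leads (u @ v) (T u v)"
      using laurent_above_uminus[OF flipped[of u v]] by (simp add: leads_def T_def)
    show "T a b \<in> laurent_above (u @ v)" if "length a = length u" "length b = length v"
      "a = u \<or> word_less u a" "b = v \<or> word_less v b" "(a, b) \<noteq> (u, v)" for a b
      unfolding T_def using that
      by (intro laurent_above_diff flipped laurent_above_word_elt word_less_append_mono) auto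
  qed
  then show ?thesis by (simp add: qbracket_def T_def scalar_mult_conv_scale)
qed

text \<open>Induction on the length, using that both parts of a split Lyndon word are Lyndon.\<close>

lemma leads_lyndon_bracket: "lyndon l \<Longrightarrow> leads l (lyndon_bracket \<alpha> l)"
proof (induction l rule: length_induct)
  case (1 l)
  show ?case
  proof (cases "length l \<le> 1")
    case True
    then show ?thesis by (subst lyndon_bracket.simps) (simp add: leads_word_elt)
  next
    case False
    then have len: "1 < length l" by simp
    let ?u = "take (lyndon_split l) l" and ?v = "drop (lyndon_split l) l"
    note split = lyndon_split_bounds[OF len]
    have "leads (?u @ ?v) (qbracket \<alpha> (lyndon_bracket \<alpha> ?u) (lyndon_bracket \<alpha> ?v))"
      using 1 split lyndon_split_lyndon[OF 1(2) len] by (intro leads_qbracket) auto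
    then show ?thesis using False by (subst lyndon_bracket.simps) simp
  qed
qed

lemma leads_word_bracket: "leads w (word_bracket \<alpha> w)"
proof -
  have "leads (concat ls) (prod_list (map (lyndon_bracket \<alpha>) ls))" if "\<forall>l\<in>set ls. lyndon l" for ls
    using that
  proof (induction ls)
    case Nil
    show ?case using leads_word_elt[of "[]"] by (simp add: word_elt_Nil)
  next
    case (Cons l ls)
    then show ?case by (auto intro!: leads_mult leads_lyndon_bracket)
  qed
  then show ?thesis
    using is_lyndon_factorization_lyndon_factorization[of w] by (metis word_bracket_def)
qed


section \<open>The quantum group as a quotient of a free algebra\<close>

lemma scale_1 [simp]: "scale 1 x = x"
  by (rule poly_mapping_eqI) simp

lemma scale_0_right [simp]: "scale a 0 = 0"
  by (rule poly_mapping_eqI) simp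

lemma scale_scale: "scale a (scale b x) = scale (a * b) x"
  by (rule poly_mapping_eqI) (simp add: mult.assoc)

lemma mult_scalar_conv_scale: "x * scalar c = scale c x"
proof -
  have "x * scalar c = (\<Sum>w\<in>Poly_Mapping.keys x. Poly_Mapping.single w (Poly_Mapping.lookup x w) * scalar c)"
    by (subst (1) poly_mapping_sum_single[of x, symmetric]) (rule sum_distrib_right)
  also have "\<dots> = (\<Sum>w\<in>Poly_Mapping.keys x. scale c (Poly_Mapping.single w (Poly_Mapping.lookup x w)))"
    by (intro sum.cong refl poly_mapping_eqI)
       (simp add: scalar_def mult_single plus_list_def lookup_single when_def)
  also have "\<dots> = scalar c * (\<Sum>w\<in>Poly_Mapping.keys x. Poly_Mapping.single w (Poly_Mapping.lookup x w))"
    by (simp only: scalar_mult_conv_scale[symmetric] sum_distrib_left)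
  finally show ?thesis by (simp add: scalar_mult_conv_scale poly_mapping_sum_single)
qed

lemma scale_mult_scale: "scale a x * scale b y = scale (a * b) (x * y)"
  for x y :: "'x free_alg"
proof -
  have "scale a x * scale b y = scalar a * (x * scalar b) * y"
    by (simp only: scalar_mult_conv_scale[symmetric] mult.assoc)
  also have "\<dots> = scalar a * (scalar b * x) * y"
    by (simp only: mult_scalar_conv_scale scalar_mult_conv_scale)
  also have "\<dots> = scalar a * (scalar b * (x * y))" by (simp only: mult.assoc)
  finally show ?thesis by (simp only: scalar_mult_conv_scale scale_scale)
qed

text \<open>The algebra homomorphism between free algebras that substitutes \<open>f x\<close> for each letter \<open>x\<close>. It
  serves both for lifting \<^const>\<open>B_elt\<close> to the free algebra on the generators of the quantum group and
  for the counit.\<close>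

definition subst_hom :: "('x \<Rightarrow> 'y free_alg) \<Rightarrow> 'x free_alg \<Rightarrow> 'y free_alg" where
  "subst_hom f = combo (\<lambda>w. prod_list (map f w))"

lemma subst_hom_add: "subst_hom f (x + y) = subst_hom f x + subst_hom f y"
  by (simp add: subst_hom_def combo_add)

lemma subst_hom_diff: "subst_hom f (x - y) = subst_hom f x - subst_hom f y"
  by (simp add: subst_hom_def combo_diff)

lemma subst_hom_uminus: "subst_hom f (- x) = - subst_hom f x"
  by (simp add: subst_hom_def combo_uminus)

lemma subst_hom_0: "subst_hom f 0 = 0"
  by (simp add: subst_hom_def)

lemma subst_hom_sum: "subst_hom f (sum g S) = (\<Sum>s\<in>S. subst_hom f (g s))"
  by (simp add: subst_hom_def combo_sum)

lemma subst_hom_scale: "subst_hom f (scale a x) = scale a (subst_hom f x)"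
  by (simp add: subst_hom_def combo_scale)

lemma subst_hom_word_elt: "subst_hom f (word_elt w) = prod_list (map f w)"
  by (simp add: subst_hom_def word_elt_def)

lemma subst_hom_1: "subst_hom f 1 = 1"
  using subst_hom_word_elt[of f "[]"] by (simp add: word_elt_Nil)

lemma scale_one_eq_scalar: "scale c 1 = scalar c"
  by (simp flip: scalar_mult_conv_scale)

lemma subst_hom_scalar: "subst_hom f (scalar c) = scalar c"
  by (simp add: subst_hom_scale subst_hom_1 flip: scale_one_eq_scalar)

lemma subst_hom_mult: "subst_hom f (x * y) = subst_hom f x * subst_hom f y"
proof -
  let ?F = "\<lambda>w. prod_list (map f w)"
  have "subst_hom f x * subst_hom f y =
     (\<Sum>u\<in>Poly_Mapping.keys x. \<Sum>v\<in>Poly_Mapping.keys y.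
        scale (Poly_Mapping.lookup x u) (?F u) * scale (Poly_Mapping.lookup y v) (?F v))"
    by (simp add: subst_hom_def combo_def sum_product)
  also have "\<dots> = subst_hom f (x * y)"
    unfolding free_alg_mult_expand[of x y]
    by (simp add: subst_hom_sum subst_hom_scale subst_hom_word_elt scale_mult_scale)
  finally show ?thesis by simp
qed

lemma ring_free_alg_ring: "ring (free_alg_ring :: 'x free_alg ring)"
proof (intro ringI abelian_groupI monoidI)
  show "\<exists>y\<in>carrier free_alg_ring. y \<oplus>\<^bsub>free_alg_ring\<^esub> x = \<zero>\<^bsub>free_alg_ring\<^esub>" for x :: "'x free_alg"
    by (rule bexI[of _ "- x"]) (simp_all add: free_alg_ring_def)
qed (simp_all add: free_alg_ring_def algebra_simps)

lemma ideal_qgroup_ideal: "ideal (qgroup_ideal \<alpha>) free_alg_ring"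
  unfolding qgroup_ideal_def
  by (rule ring.genideal_ideal[OF ring_free_alg_ring]) (simp add: free_alg_ring_def)

lemma ring_qgroup: "ring (qgroup \<alpha>)"
  unfolding qgroup_def by (rule ideal.quotient_is_ring[OF ideal_qgroup_ideal])

lemma ring_hom_qclass: "ring_hom_ring free_alg_ring (qgroup \<alpha>) (qclass \<alpha>)"
proof -
  have "qclass \<alpha> = (+>\<^bsub>free_alg_ring\<^esub>) (qgroup_ideal \<alpha>)" by (rule ext) (simp add: qclass_def)
  then show ?thesis
    unfolding qgroup_def using ideal.rcos_ring_hom_ring[OF ideal_qgroup_ideal[of \<alpha>]] by simp
qed

lemma qclass_closed [simp]: "qclass \<alpha> x \<in> carrier (qgroup \<alpha>)"
  using ring_hom_ring.homh[OF ring_hom_qclass[of \<alpha>]] by (auto simp: ring_hom_def free_alg_ring_def)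

lemma qclass_add: "qclass \<alpha> x \<oplus>\<^bsub>qgroup \<alpha>\<^esub> qclass \<alpha> y = qclass \<alpha> (x + y)"
  using ring_hom_ring.homh[OF ring_hom_qclass[of \<alpha>]] by (auto simp: ring_hom_def free_alg_ring_def)

lemma qclass_mult: "qclass \<alpha> x \<otimes>\<^bsub>qgroup \<alpha>\<^esub> qclass \<alpha> y = qclass \<alpha> (x * y)"
  using ring_hom_ring.homh[OF ring_hom_qclass[of \<alpha>]] by (auto simp: ring_hom_def free_alg_ring_def)

lemma qclass_1: "\<one>\<^bsub>qgroup \<alpha>\<^esub> = qclass \<alpha> 1"
  using ring_hom_ring.homh[OF ring_hom_qclass[of \<alpha>]] by (auto simp: ring_hom_def free_alg_ring_def)

lemma qclass_0: "\<zero>\<^bsub>qgroup \<alpha>\<^esub> = qclass \<alpha> 0"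
proof -
  interpret ring "qgroup \<alpha>" by (rule ring_qgroup)
  have "qclass \<alpha> 0 \<oplus>\<^bsub>qgroup \<alpha>\<^esub> qclass \<alpha> 0 = qclass \<alpha> 0" by (simp add: qclass_add)
  then show ?thesis by (metis qclass_closed add.r_cancel_one)
qed

lemma qclass_uminus: "\<ominus>\<^bsub>qgroup \<alpha>\<^esub> qclass \<alpha> x = qclass \<alpha> (- x)"
proof -
  interpret ring "qgroup \<alpha>" by (rule ring_qgroup)
  have "qclass \<alpha> (- x) \<oplus>\<^bsub>qgroup \<alpha>\<^esub> qclass \<alpha> x = \<zero>\<^bsub>qgroup \<alpha>\<^esub>" by (simp add: qclass_add qclass_0)
  then show ?thesis by (metis qclass_closed minus_equality)
qed

lemma qclass_eq_0_iff: "qclass \<alpha> x = qclass \<alpha> 0 \<longleftrightarrow> x \<in> qgroup_ideal \<alpha>"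
proof -
  interpret ideal "qgroup_ideal \<alpha>" free_alg_ring by (rule ideal_qgroup_ideal)
  have "qclass \<alpha> 0 = qgroup_ideal \<alpha>"
    unfolding qclass_0[symmetric] by (simp add: qgroup_def FactRing_def)
  moreover have "x \<in> qclass \<alpha> x" unfolding qclass_def by (rule a_rcos_self) (simp add: free_alg_ring_def)
  moreover have "qclass \<alpha> x = qgroup_ideal \<alpha>" if "x \<in> qgroup_ideal \<alpha>"
    unfolding qclass_def using a_rcos_zero[OF ideal_qgroup_ideal that] by simp
  ultimately show ?thesis by auto
qed

text \<open>The counit on generators. Its values are placed in the free algebra on one letter, which contains
  the scalars, so that the counit is again a substitution of letters.\<close>

fun counit_gen :: "'i qgen \<Rightarrow> unit free_alg" where
  "counit_gen (gE i) = 0"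
| "counit_gen (gF i) = 0"
| "counit_gen (gK i) = 1"
| "counit_gen (gKinv i) = 1"

lemma subst_hom_gen: "subst_hom f (word_elt [x]) = f x"
  by (simp add: subst_hom_word_elt)

text \<open>The kernel of the counit is an ideal that contains the defining relators: each term of a Serre
  relator has a factor that is mapped to \<open>0\<close>, and \<open>K\<^sub>i - K\<^sub>i\<^sup>-\<^sup>1\<close> is mapped to \<open>1 - 1\<close>.\<close>

lemma counit_qgroup_ideal:
  assumes "x \<in> qgroup_ideal \<alpha>"
  shows "subst_hom counit_gen x = 0"
proof -
  let ?\<epsilon> = "subst_hom counit_gen :: 'a qgen free_alg \<Rightarrow> unit free_alg"
  have hom: "ring_hom_ring free_alg_ring free_alg_ring ?\<epsilon>"
    by (rule ring_hom_ringI[OF ring_free_alg_ring ring_free_alg_ring])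
       (simp_all add: free_alg_ring_def subst_hom_add subst_hom_mult subst_hom_1)
  have "ideal (a_kernel free_alg_ring free_alg_ring ?\<epsilon>) free_alg_ring"
    by (rule ring_hom_ring.kernel_is_ideal[OF hom])
  moreover have "a_kernel free_alg_ring free_alg_ring ?\<epsilon> = {x. ?\<epsilon> x = 0}"
    by (simp add: a_kernel_def' free_alg_ring_def)
  moreover have "qgroup_relators \<alpha> \<subseteq> {x. ?\<epsilon> x = 0}"
  proof -
    have "?\<epsilon> (serre \<alpha> gE i j) = 0" "?\<epsilon> (serre \<alpha> gF i j) = 0" for i j
      by (simp_all add: serre_def Let_def subst_hom_sum subst_hom_mult subst_hom_gen)
    then show ?thesis
      by (auto simp: qgroup_relators_def subst_hom_diff subst_hom_mult subst_hom_gen subst_hom_1 subst_hom_0)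
  qed
  ultimately have "qgroup_ideal \<alpha> \<subseteq> {x. ?\<epsilon> x = 0}"
    unfolding qgroup_ideal_def by (metis ring.genideal_minimal ring_free_alg_ring)
  with assms show ?thesis by auto
qed

lemma inj_scalar: "scalar a = scalar b \<longleftrightarrow> a = b"
  by (metis scalar_def lookup_single_eq)

lemma scalar_diff: "scalar (a - b) = scalar a - scalar b"
  by (simp add: scalar_def single_diff)

lemma scalar_add: "scalar (a + b) = scalar a + scalar b"
  by (simp add: scalar_def single_add)

lemma scalar_mult: "scalar (a * b) = scalar a * scalar b"
  by (simp add: scalar_def mult_single plus_list_def)

lemma scalar_1: "scalar 1 = 1"
  by (simp add: scalar_def flip: zero_list_def)

lemma scalar_0: "scalar 0 = 0"
  by (simp add: scalar_def)

lemma qclass_diff_eq_0_iff: "qclass \<alpha> x = qclass \<alpha> y \<longleftrightarrow> qclass \<alpha> (x - y) = qclass \<alpha> 0"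
proof -
  interpret ring "qgroup \<alpha>" by (rule ring_qgroup)
  show ?thesis
    by (metis add.l_cancel_one' add_diff_cancel_left' diff_add_cancel qclass_0 qclass_add qclass_closed l_zero)
qed

text \<open>The counit fixes the scalars, so the field embeds into the quantum group, which therefore is
  nonzero.\<close>

lemma qclass_scalar_inj: "qclass \<alpha> (scalar a) = qclass \<alpha> (scalar b) \<longleftrightarrow> a = b"
proof
  assume "qclass \<alpha> (scalar a) = qclass \<alpha> (scalar b)"
  then have "scalar (a - b) \<in> qgroup_ideal \<alpha>"
    by (simp add: qclass_diff_eq_0_iff[of \<alpha> "scalar a"] qclass_eq_0_iff scalar_diff)
  then have "subst_hom counit_gen (scalar (a - b) :: 'a qgen free_alg) = 0" by (rule counit_qgroup_ideal)
  then have "(scalar (a - b) :: unit free_alg) = scalar 0" by (simp only: subst_hom_scalar scalar_0)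
  then show "a = b" by (simp add: inj_scalar)
qed simp

lemma qsmult_qclass: "qsmult \<alpha> a (qclass \<alpha> x) = qclass \<alpha> (scale a x)"
  by (simp add: qsmult_def qclass_mult scalar_mult_conv_scale)

lemma lincomb_qclass:
  fixes f :: "'x \<Rightarrow> 'i qgen free_alg"
  shows "lincomb \<alpha> (\<lambda>x. qclass \<alpha> (f x)) c = qclass \<alpha> (combo f c)"
proof -
  interpret ring "qgroup \<alpha>" by (rule ring_qgroup)
  have "(\<Oplus>\<^bsub>qgroup \<alpha>\<^esub>x\<in>S. qclass \<alpha> (g x)) = qclass \<alpha> (sum g S)" if "finite S"
    for S :: "'x set" and g :: "'x \<Rightarrow> 'i qgen free_alg"
    using that by (induction S) (simp_all add: qclass_0 qclass_add Pi_def)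
  then show ?thesis by (simp add: lincomb_def combo_def qsmult_qclass)
qed

lemma lincomb_cong:
  assumes "\<And>x. x \<in> Poly_Mapping.keys c \<Longrightarrow> f x = g x" "\<And>x. x \<in> Poly_Mapping.keys c \<Longrightarrow> g x \<in> carrier (qgroup \<alpha>)"
  shows "lincomb \<alpha> f c = lincomb \<alpha> g c"
proof -
  interpret ring "qgroup \<alpha>" by (rule ring_qgroup)
  show ?thesis
    unfolding lincomb_def using assms by (intro finsum_cong') (auto simp: qsmult_def)
qed

definition B_lift :: "('i \<Rightarrow> qfield) \<Rightarrow> 'i \<Rightarrow> 'i qgen free_alg" where
  "B_lift \<xi> i = gen (gF i) + scalar (\<xi> i) * gen (gE i) * gen (gKinv i)"

lemma B_word_conv_qclass: "B_word \<alpha> \<xi> w = qclass \<alpha> (prod_list (map (B_lift \<xi>) w))"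
  by (induction w) (simp_all add: B_word_def B_gen_def B_lift_def qclass_1 qclass_mult)

lemma B_elt_conv_qclass: "B_elt \<alpha> \<xi> x = qclass \<alpha> (subst_hom (B_lift \<xi>) x)"
  using lincomb_qclass[of \<alpha> "\<lambda>w. prod_list (map (B_lift \<xi>) w)" x]
  by (simp add: B_elt_def subst_hom_def flip: B_word_conv_qclass)

lemma B_elt_add: "B_elt \<alpha> \<xi> (x + y) = B_elt \<alpha> \<xi> x \<oplus>\<^bsub>qgroup \<alpha>\<^esub> B_elt \<alpha> \<xi> y"
  by (simp add: B_elt_conv_qclass qclass_add subst_hom_add)

lemma B_elt_mult: "B_elt \<alpha> \<xi> (x * y) = B_elt \<alpha> \<xi> x \<otimes>\<^bsub>qgroup \<alpha>\<^esub> B_elt \<alpha> \<xi> y"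
  by (simp add: B_elt_conv_qclass qclass_mult subst_hom_mult)

lemma B_elt_scalar: "B_elt \<alpha> \<xi> (scalar c) = qclass \<alpha> (scalar c)"
  by (simp add: B_elt_conv_qclass subst_hom_scalar)

lemma B_elt_word_elt: "B_elt \<alpha> \<xi> (word_elt w) = B_word \<alpha> \<xi> w"
  by (simp add: B_elt_conv_qclass subst_hom_word_elt B_word_conv_qclass)

lemma B_elt_eq_iff: "B_elt \<alpha> \<xi> x = B_elt \<alpha> \<xi> y \<longleftrightarrow> B_elt \<alpha> \<xi> (x - y) = B_elt \<alpha> \<xi> 0"
  unfolding B_elt_conv_qclass subst_hom_diff subst_hom_0 by (rule qclass_diff_eq_0_iff)

lemma lincomb_B_elt: "lincomb \<alpha> (\<lambda>x. B_elt \<alpha> \<xi> (f x)) c = B_elt \<alpha> \<xi> (combo f c)"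
  unfolding B_elt_conv_qclass lincomb_qclass by (simp add: subst_hom_def combo_combo)

lemma scalar_mult_word_elt: "scalar c * word_elt w = Poly_Mapping.single w c"
  by (simp add: scalar_mult_conv_scale scale_word_elt)

text \<open>The image of \<^const>\<open>B_elt\<close> is a subring that contains the generators; conversely each value is
  built from scalars and products of generators.\<close>

lemma carrier_iqgroup: "carrier (iqgroup \<alpha> \<xi>) = range (B_elt \<alpha> \<xi>)"
proof -
  interpret ring "qgroup \<alpha>" by (rule ring_qgroup)
  let ?H = "range (\<lambda>c. qclass \<alpha> (scalar c)) \<union> range (B_gen \<alpha> \<xi>)"
  have "u \<in> range (B_elt \<alpha> \<xi>)" if "u \<in> generate_ring (qgroup \<alpha>) ?H" for u
    using that
  proof induction
    case one
    have "\<one>\<^bsub>qgroup \<alpha>\<^esub> = B_elt \<alpha> \<xi> (scalar 1)" by (simp add: qclass_1 B_elt_conv_qclass subst_hom_1 scalar_1)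
    then show ?case by blast
  next
    case (incl h)
    moreover have "B_gen \<alpha> \<xi> i = B_elt \<alpha> \<xi> (word_elt [i])" for i
      by (simp add: B_elt_conv_qclass subst_hom_gen B_lift_def B_gen_def)
    ultimately show ?case by (auto simp flip: B_elt_scalar[of \<alpha> \<xi>])
  next
    case (a_inv h)
    then obtain x where "h = B_elt \<alpha> \<xi> x" by blast
    then have "\<ominus>\<^bsub>qgroup \<alpha>\<^esub> h = B_elt \<alpha> \<xi> (- x)"
      by (simp add: B_elt_conv_qclass qclass_uminus subst_hom_uminus)
    then show ?case by blast
  next
    case (eng_add h1 h2)
    then obtain x y where "h1 = B_elt \<alpha> \<xi> x" "h2 = B_elt \<alpha> \<xi> y" by blast
    then show ?case by (simp flip: B_elt_add)
  next
    case (eng_mult h1 h2)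
    then obtain x y where "h1 = B_elt \<alpha> \<xi> x" "h2 = B_elt \<alpha> \<xi> y" by blast
    then show ?case by (simp flip: B_elt_mult)
  qed
  moreover have "B_elt \<alpha> \<xi> x \<in> generate_ring (qgroup \<alpha>) ?H" for x
  proof -
    have word: "B_word \<alpha> \<xi> w \<in> generate_ring (qgroup \<alpha>) ?H" for w
      by (induction w) (auto simp: B_word_def intro!: generate_ring.one generate_ring.eng_mult intro: generate_ring.incl)
    have single: "B_elt \<alpha> \<xi> (Poly_Mapping.single w c) \<in> generate_ring (qgroup \<alpha>) ?H" for w c
      unfolding scalar_mult_word_elt[symmetric] B_elt_mult B_elt_scalar B_elt_word_elt
      by (intro generate_ring.eng_mult word, rule generate_ring.incl) auto
    have "B_elt \<alpha> \<xi> (\<Sum>w\<in>S. Poly_Mapping.single w (Poly_Mapping.lookup x w)) \<in> generate_ring (qgroup \<alpha>) ?H"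
      if "finite S" for S
      using that
    proof (induction S)
      case empty
      have "B_elt \<alpha> \<xi> 0 = \<zero>\<^bsub>qgroup \<alpha>\<^esub>" by (simp add: B_elt_conv_qclass subst_hom_0 qclass_0)
      then show ?case using zero_in_generate[of ?H] by simp
    next
      case (insert w S)
      then show ?case by (simp add: B_elt_add single generate_ring.eng_add)
    qed
    from this[OF finite_keys[of x]] show ?thesis by (simp add: poly_mapping_sum_single)
  qed
  ultimately show ?thesis by (auto simp: iqgroup_def iqgroup_carrier_def)
qed

lemma lookup_map_0: "f 0 = 0 \<Longrightarrow> Poly_Mapping.lookup (Poly_Mapping.map f x) w = f (Poly_Mapping.lookup x w)"
  by transfer (auto simp: when_def)

text \<open>A rational function is a quotient of rational polynomials in \<open>q\<close>, on which the involution is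
  determined by its being rational-linear and by its value at \<open>q\<close>. Hence the scalars are mapped to
  scalars, and as the words are fixed the involution acts on coefficients only.\<close>

lemma bar_involution_coefficients:
  assumes "bar_involution \<alpha> \<xi> bar"
  obtains \<sigma> where "q_inversion \<sigma>" "\<And>x. bar (B_elt \<alpha> \<xi> x) = B_elt \<alpha> \<xi> (Poly_Mapping.map \<sigma> x)"
proof -
  let ?s = "\<lambda>c. qclass \<alpha> (scalar c)"
  let ?L = "B_elt \<alpha> \<xi>"
  interpret ring "qgroup \<alpha>" by (rule ring_qgroup)
  have iso: "bar \<in> ring_iso (iqgroup \<alpha> \<xi>) (iqgroup \<alpha> \<xi>)"
    and bar_rat: "\<And>r u. u \<in> carrier (iqgroup \<alpha> \<xi>) \<Longrightarrow> bar (qsmult \<alpha> (of_rat r) u) = qsmult \<alpha> (of_rat r) (bar u)"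
    and bar_gen: "\<And>i. bar (B_gen \<alpha> \<xi> i) = B_gen \<alpha> \<xi> i"
    and bar_qq: "bar (?s qq) = ?s (inverse qq)"
    using assms by (auto simp: bar_involution_def)
  have L_in: "?L x \<in> carrier (iqgroup \<alpha> \<xi>)" for x by (simp add: carrier_iqgroup)
  have s_in: "?s c \<in> carrier (iqgroup \<alpha> \<xi>)" for c using L_in[of "scalar c"] by (simp only: B_elt_scalar)
  have bar_closed: "bar u \<in> carrier (qgroup \<alpha>)" if "u \<in> carrier (iqgroup \<alpha> \<xi>)" for u
  proof -
    have "bar u \<in> carrier (iqgroup \<alpha> \<xi>)" using ring_iso_memE(1)[OF iso that] .
    then show ?thesis by (auto simp: carrier_iqgroup B_elt_conv_qclass)
  qed
  have bar_add: "bar (u \<oplus>\<^bsub>qgroup \<alpha>\<^esub> v) = bar u \<oplus>\<^bsub>qgroup \<alpha>\<^esub> bar v"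
    and bar_mult: "bar (u \<otimes>\<^bsub>qgroup \<alpha>\<^esub> v) = bar u \<otimes>\<^bsub>qgroup \<alpha>\<^esub> bar v"
    if "u \<in> carrier (iqgroup \<alpha> \<xi>)" "v \<in> carrier (iqgroup \<alpha> \<xi>)" for u v
    using ring_iso_memE(2,3)[OF iso that] by (simp_all add: iqgroup_def)
  have bar_1: "bar (?s 1) = ?s 1"
    using ring_iso_memE(4)[OF iso] by (simp add: iqgroup_def qclass_1 scalar_1)
  have bar_inj: "u = v" if "bar u = bar v" "u \<in> carrier (iqgroup \<alpha> \<xi>)" "v \<in> carrier (iqgroup \<alpha> \<xi>)" for u v
    using ring_iso_memE(5)[OF iso] that by (auto simp: bij_betw_def inj_on_def)
  have s_add: "?s (a + b) = ?s a \<oplus>\<^bsub>qgroup \<alpha>\<^esub> ?s b" and s_mult: "?s (a * b) = ?s a \<otimes>\<^bsub>qgroup \<alpha>\<^esub> ?s b" for a b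
    by (simp_all add: qclass_add qclass_mult scalar_add scalar_mult)
  have bar_s_rat: "bar (?s (of_rat r)) = ?s (of_rat r)" for r
    using bar_rat[OF s_in, of r 1] bar_1 by (simp add: qsmult_qclass scale_one_eq_scalar scalar_1)
  have bar_poly: "bar (?s (poly (map_poly of_rat p) qq)) = ?s (poly (map_poly of_rat p) (inverse qq))" for p
  proof (induction p)
    case 0
    show ?case using bar_s_rat[of 0] by simp
  next
    case (pCons a p)
    have "bar (?s (qq * poly (map_poly of_rat p) qq)) = ?s (inverse qq * poly (map_poly of_rat p) (inverse qq))"
      by (simp only: s_mult bar_mult[OF s_in s_in] bar_qq pCons(2))
    then have "bar (?s (of_rat a + qq * poly (map_poly of_rat p) qq)) =
        ?s (of_rat a + inverse qq * poly (map_poly of_rat p) (inverse qq))"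
      by (simp only: s_add bar_add[OF s_in s_in] bar_s_rat)
    then show ?case by (simp add: map_poly_pCons)
  qed
  have "\<exists>d. bar (?s c) = ?s d" for c
  proof (cases c)
    case (Fract a b)
    define A B where "A = poly (map_poly of_rat a) qq" and "B = poly (map_poly of_rat b) qq"
    define A' B' where "A' = poly (map_poly of_rat a) (inverse qq)" and "B' = poly (map_poly of_rat b) (inverse qq)"
    have cB: "c * B = A" and B: "B \<noteq> 0"
      using Fract by (simp_all add: A_def B_def eval_rat_qq eq_fract Zero_fract_def)
    have AB': "bar (?s A) = ?s A'" "bar (?s B) = ?s B'" by (simp_all add: A_def A'_def B_def B'_def bar_poly)
    \<comment> \<open>The denominator stays nonzero because the involution is injective.\<close>
    have "B' \<noteq> 0"
    proof
      assume "B' = 0"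
      then have "bar (?s B) = bar (?s 0)" using bar_s_rat[of 0] AB'(2) by simp
      then have "?s B = ?s 0" by (rule bar_inj) (rule s_in)+
      then show False using B by (simp add: qclass_scalar_inj)
    qed
    have "bar (?s c) \<otimes>\<^bsub>qgroup \<alpha>\<^esub> ?s B' = ?s A'"
      using bar_mult[OF s_in s_in, of c B] AB' cB by (simp add: s_mult[symmetric])
    moreover have "bar (?s c) \<otimes>\<^bsub>qgroup \<alpha>\<^esub> ?s B' \<otimes>\<^bsub>qgroup \<alpha>\<^esub> ?s (1 / B') = bar (?s c)"
      using \<open>B' \<noteq> 0\<close> bar_closed[OF s_in] by (simp add: m_assoc s_mult[symmetric] scalar_1 flip: qclass_1)
    ultimately have "bar (?s c) = ?s (A' * (1 / B'))" by (simp only: s_mult)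
    then show ?thesis by blast
  qed
  then obtain \<sigma> where \<sigma>: "\<And>c. bar (?s c) = ?s (\<sigma> c)" by metis
  have "q_inversion \<sigma>"
  proof
    fix a b
    show "\<sigma> (a + b) = \<sigma> a + \<sigma> b"
      using bar_add[OF s_in s_in, of a b] by (simp add: \<sigma> qclass_scalar_inj flip: s_add)
    show "\<sigma> (a * b) = \<sigma> a * \<sigma> b"
      using bar_mult[OF s_in s_in, of a b] by (simp add: \<sigma> qclass_scalar_inj flip: s_mult)
    show "\<sigma> 1 = 1" using bar_1 by (simp add: \<sigma> qclass_scalar_inj)
    show "\<sigma> qq = inverse qq" using bar_qq by (simp add: \<sigma> qclass_scalar_inj)
  qed
  then interpret q_inversion \<sigma> .
  have bar_word: "bar (B_word \<alpha> \<xi> w) = B_word \<alpha> \<xi> w" for w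
  proof (induction w)
    case Nil
    show ?case using bar_1 by (simp add: B_word_def qclass_1 scalar_1)
  next
    case (Cons i w)
    have "bar (?L (word_elt [i]) \<otimes>\<^bsub>qgroup \<alpha>\<^esub> ?L (word_elt w)) =
        bar (?L (word_elt [i])) \<otimes>\<^bsub>qgroup \<alpha>\<^esub> bar (?L (word_elt w))"
      by (rule bar_mult[OF L_in L_in])
    moreover have "?L (word_elt [i]) = B_gen \<alpha> \<xi> i"
      by (simp add: B_elt_conv_qclass subst_hom_gen B_lift_def B_gen_def)
    ultimately show ?case using Cons bar_gen by (simp add: B_elt_word_elt) (simp add: B_word_def)
  qed
  have "bar (?L (Poly_Mapping.single w c)) = ?L (Poly_Mapping.single w (\<sigma> c))" for w c
    unfolding scalar_mult_word_elt[symmetric] B_elt_mult bar_mult[OF L_in L_in]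
    by (simp add: B_elt_scalar B_elt_word_elt \<sigma> bar_word)
  note bar_single = this
  have bar_sum: "bar (?L (\<Sum>w\<in>S. Poly_Mapping.single w (f w))) = ?L (\<Sum>w\<in>S. Poly_Mapping.single w (\<sigma> (f w)))"
    if "finite S" for S f
    using that
  proof (induction S)
    case empty
    show ?case using bar_s_rat[of 0] B_elt_scalar[of \<alpha> \<xi> 0] by (simp add: scalar_0)
  next
    case (insert w S)
    then show ?case by (simp add: B_elt_add bar_add[OF L_in L_in] bar_single)
  qed
  have "bar (?L x) = ?L (Poly_Mapping.map \<sigma> x)" for x
  proof -
    have "Poly_Mapping.map \<sigma> x = (\<Sum>w\<in>Poly_Mapping.keys x. Poly_Mapping.single w (\<sigma> (Poly_Mapping.lookup x w)))"
    proof (rule poly_mapping_eqI)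
      fix w
      have "Poly_Mapping.lookup (\<Sum>v\<in>Poly_Mapping.keys x. Poly_Mapping.single v (\<sigma> (Poly_Mapping.lookup x v))) w
        = (\<Sum>v\<in>Poly_Mapping.keys x. if v = w then \<sigma> (Poly_Mapping.lookup x w) else 0)"
        by (auto simp: lookup_sum lookup_single when_def intro!: sum.cong)
      then show "Poly_Mapping.lookup (Poly_Mapping.map \<sigma> x) w =
          Poly_Mapping.lookup (\<Sum>v\<in>Poly_Mapping.keys x. Poly_Mapping.single v (\<sigma> (Poly_Mapping.lookup x v))) w"
        by (simp add: lookup_map_0 \<sigma>_0 in_keys_iff)
    qed
    then show ?thesis using bar_sum[OF finite_keys[of x], of "Poly_Mapping.lookup x"] by (simp add: poly_mapping_sum_single)
  qed
  with \<open>q_inversion \<sigma>\<close> that show thesis by blast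
qed


section \<open>The canonical basis\<close>

lemma word_prec_trans: "word_prec x y \<Longrightarrow> word_prec y z \<Longrightarrow> word_prec x z"
  by (auto simp: word_prec_def intro: word_less_trans)

lemma word_prec_irrefl: "\<not> word_prec x x"
  by (simp add: word_prec_def)

text \<open>Over a finite alphabet each word has only finitely many predecessors, whose number is a measure
  that shows well-foundedness.\<close>

lemma well_order_word_prec: "well_order_relation (word_prec :: 'i::{finite,linorder} list \<Rightarrow> _)"
proof
  have fin: "finite {x. word_prec x w}" for w :: "'i list"
    by (rule finite_subset[OF _ finite_lists_length_le[of UNIV "length w"]]) (auto simp: word_prec_def)
  have "card {x. word_prec x v} < card {x. word_prec x w}" if "word_prec v w" for v w :: "'i list"
  proof (rule psubset_card_mono[OF fin])
    have "v \<in> {x. word_prec x w}" "v \<notin> {x. word_prec x v}" using that word_prec_irrefl by auto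
    moreover have "{x. word_prec x v} \<subseteq> {x. word_prec x w}" using that by (auto intro: word_prec_trans)
    ultimately show "{x. word_prec x v} \<subset> {x. word_prec x w}" by blast
  qed
  then show "wfP (word_prec :: 'i list \<Rightarrow> _)"
    by (intro wfp_if_convertible_to_nat[of _ "\<lambda>w. card {x. word_prec x w}"])
  show "word_prec x y \<Longrightarrow> word_prec y z \<Longrightarrow> word_prec x z" for x y z :: "'i list"
    by (rule word_prec_trans)
  show "x \<noteq> y \<Longrightarrow> word_prec x y \<or> word_prec y x" for x y :: "'i list"
    using word_less_linear[of x y] by (auto simp: word_prec_def)
qed

text \<open>In a nontrivial relation between good words, dividing by the largest coefficient expresses the
  largest word \<open>m\<close> by smaller ones. This contradicts that \<open>m\<close> is good, except for \<open>m = []\<close>, where the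
  relation says that a nonzero scalar vanishes.\<close>

lemma good_words_independent:
  fixes \<alpha> :: "'i::{finite,linorder} \<Rightarrow> 'v::euclidean_space"
  assumes "Poly_Mapping.keys d \<subseteq> good_words \<alpha> \<xi>" "B_elt \<alpha> \<xi> d = B_elt \<alpha> \<xi> 0"
  shows "d = 0"
proof (rule ccontr)
  interpret well_order_relation "word_prec :: 'i list \<Rightarrow> _" by (rule well_order_word_prec)
  assume "d \<noteq> 0"
  then obtain m where m: "m \<in> Poly_Mapping.keys d" "\<forall>w\<in>Poly_Mapping.keys d. w = m \<or> word_prec w m"
    by (rule max_key)
  define a where "a = Poly_Mapping.lookup d m"
  have a: "a \<noteq> 0" using m by (simp add: a_def in_keys_iff)
  define c where "c = word_elt m - scale (1 / a) d"
  have lc: "Poly_Mapping.lookup c w = (if w = m then 0 else - Poly_Mapping.lookup d w / a)" for w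
    using a by (simp add: c_def a_def lookup_minus word_elt_def lookup_single)
  have "Poly_Mapping.keys c \<subseteq> {w. word_prec w m}"
    using m(2) by (auto simp: in_keys_iff lc split: if_splits)
  moreover have "B_word \<alpha> \<xi> m = lincomb \<alpha> (B_word \<alpha> \<xi>) c"
  proof -
    have "qsmult \<alpha> (1 / a) (B_elt \<alpha> \<xi> d) = qsmult \<alpha> (1 / a) (B_elt \<alpha> \<xi> 0)" using assms(2) by simp
    then have "B_elt \<alpha> \<xi> (word_elt m - c) = B_elt \<alpha> \<xi> 0"
      by (simp add: c_def B_elt_conv_qclass qsmult_qclass subst_hom_scale subst_hom_0)
    then have "B_elt \<alpha> \<xi> (word_elt m) = B_elt \<alpha> \<xi> c" using B_elt_eq_iff by blast
    then show ?thesis by (simp add: B_elt_word_elt) (simp add: B_elt_def)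
  qed
  moreover have "m \<in> good_words \<alpha> \<xi>" using m assms by auto
  ultimately have "m = []" by (auto simp: good_words_def)
  then have "w = []" if "w \<in> Poly_Mapping.keys d" for w
    using m(2) that by (auto simp: word_prec_def word_less_def)
  then have "d = scalar a"
    using \<open>m = []\<close> by (intro poly_mapping_eqI) (auto simp: a_def scalar_def lookup_single when_def in_keys_iff)
  then have "qclass \<alpha> (scalar a) = qclass \<alpha> (scalar 0)"
    using assms(2) B_elt_scalar[of \<alpha> \<xi> a] B_elt_scalar[of \<alpha> \<xi> 0] by (simp add: scalar_0)
  then show False using a by (simp add: qclass_scalar_inj)
qed

lemma B_elt_inj_on_good_words:
  fixes \<alpha> :: "'i::{finite,linorder} \<Rightarrow> 'v::euclidean_space"
  assumes "Poly_Mapping.keys x \<subseteq> good_words \<alpha> \<xi>" "Poly_Mapping.keys y \<subseteq> good_words \<alpha> \<xi>"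
    "B_elt \<alpha> \<xi> x = B_elt \<alpha> \<xi> y"
  shows "x = y"
  using good_words_independent[OF keys_diff_subset[OF assms(1,2)]] assms(3)
  by (simp flip: B_elt_eq_iff)

theorem theorem5p1p12:
  fixes \<Phi> :: "'v::euclidean_space set"
    and \<alpha> :: "'i::{finite,linorder} \<Rightarrow> 'v"
    and \<xi> :: "'i \<Rightarrow> qfield"
    and bar :: "'i qgroup_elt \<Rightarrow> 'i qgroup_elt"
  assumes "simple_lie_root_datum \<Phi> \<alpha>"
    and "\<And>i. \<xi> i \<noteq> 0"
    and "bar_involution \<alpha> \<xi> bar"
    and "integrality_condition \<alpha> \<xi>"
  shows "\<exists>!C. C \<in> good_words \<alpha> \<xi> \<rightarrow>\<^sub>E carrier (iqgroup \<alpha> \<xi>) \<and>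
           iq_basis \<alpha> \<xi> (good_words \<alpha> \<xi>) C \<and>
           (\<forall>g\<in>good_words \<alpha> \<xi>.
              bar (C g) = C g \<and>
              (\<exists>p. Poly_Mapping.keys p \<subseteq> {w \<in> good_words \<alpha> \<xi>. word_prec w g} \<and>
                   (\<forall>w. Poly_Mapping.lookup p w \<in> q_int_qpolys) \<and>
                   C g = B_elt \<alpha> \<xi> (word_bracket \<alpha> g) \<oplus>\<^bsub>qgroup \<alpha>\<^esub>
                         lincomb \<alpha> (\<lambda>w. B_elt \<alpha> \<xi> (word_bracket \<alpha> w)) p))"
proof -
  let ?L = "B_elt \<alpha> \<xi>"
  define G where "G = good_words \<alpha> \<xi>"
  have inj: "x = y" if "Poly_Mapping.keys x \<subseteq> G" "Poly_Mapping.keys y \<subseteq> G" "?L x = ?L y" for x y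
    using that unfolding G_def by (rule B_elt_inj_on_good_words)
  obtain \<sigma> where "q_inversion \<sigma>" and bar: "\<And>x. bar (?L x) = ?L (Poly_Mapping.map \<sigma> x)"
    using bar_involution_coefficients[OF assms(3)] by blast
  then interpret q_inversion \<sigma> by simp
  have "\<forall>w. \<exists>c. Poly_Mapping.keys c \<subseteq> {g \<in> G. word_prec g w \<or> g = w} \<and>
        (\<forall>g. Poly_Mapping.lookup c g \<in> int_laurent) \<and> B_word \<alpha> \<xi> w = ?L c"
    using assms(4) by (simp add: integrality_condition_def G_def B_elt_def)
  \<comment> \<open>\<open>r w\<close> is the expansion of the word \<open>w\<close> in good words, and \<open>combo r\<close> rewrites a vector in good
    words without changing its image under \<open>L\<close>.\<close>
  then obtain r where "\<forall>w. Poly_Mapping.keys (r w) \<subseteq> {g \<in> G. word_prec g w \<or> g = w} \<and>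
        (\<forall>g. Poly_Mapping.lookup (r w) g \<in> int_laurent) \<and> B_word \<alpha> \<xi> w = ?L (r w)"
    by (rule choice[THEN exE])
  then have r: "\<And>w. Poly_Mapping.keys (r w) \<subseteq> {g \<in> G. word_prec g w \<or> g = w}"
    "\<And>w g. Poly_Mapping.lookup (r w) g \<in> int_laurent" "\<And>w. B_word \<alpha> \<xi> w = ?L (r w)"
    by simp_all
  have r_good: "r g = word_elt g" if "g \<in> G" for g
    using that r(1)[of g] r(3)[of g] by (intro inj) (auto simp: word_elt_def B_elt_word_elt[symmetric])
  have L_reduce: "?L (combo r x) = ?L x" for x
  proof -
    have "?L (combo r x) = lincomb \<alpha> (B_word \<alpha> \<xi>) x"
      unfolding lincomb_B_elt[symmetric] r(3)[symmetric] ..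
    then show ?thesis by (simp add: B_elt_def)
  qed
  have keys_reduce: "Poly_Mapping.keys (combo r x) \<subseteq> G" for x
    using keys_combo[of r x] r(1) by blast
  \<comment> \<open>The coordinates of \<open>[g]\<close> in the basis of good words; subtracting the leading word shows that they
    are unitriangular.\<close>
  define b where "b g = combo r (word_bracket \<alpha> g)" for g
  have b_eq: "b g = r g + combo r (word_bracket \<alpha> g - word_elt g)" for g
    by (simp add: b_def combo_diff word_elt_def)
  have keys_lower: "Poly_Mapping.keys (combo r (word_bracket \<alpha> g - word_elt g)) \<subseteq> {w\<in>G. word_prec w g}" for g
  proof
    fix w assume "w \<in> Poly_Mapping.keys (combo r (word_bracket \<alpha> g - word_elt g))"
    then obtain z where z: "z \<in> Poly_Mapping.keys (word_bracket \<alpha> g - word_elt g)" "w \<in> Poly_Mapping.keys (r z)"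
      using keys_combo[of r] by blast
    have "word_prec z g"
      using leads_word_bracket[of g \<alpha>] z(1) by (auto simp: leads_def laurent_above_def word_prec_def)
    then show "w \<in> {w\<in>G. word_prec w g}" using r(1)[of z] z(2) by (auto intro: word_prec_trans)
  qed
  have wo: "well_order_relation (word_prec :: 'i list \<Rightarrow> _)" by (rule well_order_word_prec)
  interpret unitriangular word_prec G b
  proof (intro unitriangular.intro wo unitriangular_axioms.intro)
    fix g assume g: "g \<in> G"
    show "Poly_Mapping.keys (b g) \<subseteq> {w\<in>G. w = g \<or> word_prec w g}"
      using Poly_Mapping.keys_add[of "r g"] r(1)[of g] keys_lower[of g] unfolding b_eq by blast
    have "Poly_Mapping.lookup (combo r (word_bracket \<alpha> g - word_elt g)) g = 0"
      using word_prec_irrefl by (intro lookup_eq_0_outside[OF keys_lower]) auto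
    then show "Poly_Mapping.lookup (b g) g = 1"
      unfolding b_eq r_good[OF g] by (simp add: lookup_add word_elt_def)
  qed
  have b_laurent: "Poly_Mapping.lookup (b g) w \<in> int_laurent" for g w
    unfolding b_def lookup_combo
    using r(2) leads_lookup(2)[OF leads_word_bracket] by (intro int_laurent_sum int_laurent_mult)
  have "\<forall>g\<in>G. \<exists>p. Poly_Mapping.keys p \<subseteq> {w\<in>G. word_prec w g} \<and>
      (\<forall>w. Poly_Mapping.lookup p w \<in> q_int_qpolys) \<and>
      (\<forall>w. \<sigma> (Poly_Mapping.lookup (b g + combo b p) w) = Poly_Mapping.lookup (b g + combo b p) w)"
  proof
    fix g assume g: "g \<in> G"
    obtain p where "Poly_Mapping.keys p \<subseteq> {w\<in>G. word_prec w g}" "\<And>w. Poly_Mapping.lookup p w \<in> q_int_qpolys"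
      "\<And>w. \<sigma> (Poly_Mapping.lookup (b g + combo b p) w) = Poly_Mapping.lookup (b g + combo b p) w"
      using bar_invariant_correction_exists[OF int_laurent_add int_laurent_mult int_laurent_0 b_laurent
          q_int_qpolys_subset_int_laurent q_int_qpolys_0 \<sigma>_0 \<sigma>_1 int_laurent_correction g]
      by blast
    then show "\<exists>p. Poly_Mapping.keys p \<subseteq> {w\<in>G. word_prec w g} \<and>
      (\<forall>w. Poly_Mapping.lookup p w \<in> q_int_qpolys) \<and>
      (\<forall>w. \<sigma> (Poly_Mapping.lookup (b g + combo b p) w) = Poly_Mapping.lookup (b g + combo b p) w)"
      by blast
  qed
  \<comment> \<open>\<open>P g\<close> holds the coefficients \<open>p\<^sub>g\<^sub>,\<^sub>w\<close>, and \<open>c g\<close> the coordinates of the canonical basis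
    element.\<close>
  then obtain P where "\<forall>g\<in>G. Poly_Mapping.keys (P g) \<subseteq> {w\<in>G. word_prec w g} \<and>
      (\<forall>w. Poly_Mapping.lookup (P g) w \<in> q_int_qpolys) \<and>
      (\<forall>w. \<sigma> (Poly_Mapping.lookup (b g + combo b (P g)) w) = Poly_Mapping.lookup (b g + combo b (P g)) w)"
    by (rule bchoice[THEN exE])
  then have P: "\<And>g. g \<in> G \<Longrightarrow> Poly_Mapping.keys (P g) \<subseteq> {w\<in>G. word_prec w g}"
    "\<And>g w. g \<in> G \<Longrightarrow> Poly_Mapping.lookup (P g) w \<in> q_int_qpolys"
    "\<And>g w. g \<in> G \<Longrightarrow> \<sigma> (Poly_Mapping.lookup (b g + combo b (P g)) w) = Poly_Mapping.lookup (b g + combo b (P g)) w"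
    by simp_all
  define c where "c g = b g + combo b (P g)" for g
  have b_G: "Poly_Mapping.keys (b g) \<subseteq> G" for g
    unfolding b_def by (rule keys_reduce)
  have combo_G: "Poly_Mapping.keys (b g + combo b p) \<subseteq> G" for g p
    using Poly_Mapping.keys_add[of "b g" "combo b p"] keys_combo[of b p] b_G by blast
  have L_b: "?L (word_bracket \<alpha> g) \<oplus>\<^bsub>qgroup \<alpha>\<^esub> lincomb \<alpha> (\<lambda>w. ?L (word_bracket \<alpha> w)) p = ?L (b g + combo b p)" for g p
  proof -
    have "?L (word_bracket \<alpha> w) = ?L (b w)" for w by (simp add: b_def L_reduce)
    then show ?thesis by (simp add: lincomb_B_elt B_elt_add)
  qed
  \<comment> \<open>The corrected family is unitriangular again, hence a basis.\<close>
  have basis_c: "\<exists>!p. Poly_Mapping.keys p \<subseteq> G \<and> x = combo c p" if "Poly_Mapping.keys x \<subseteq> G" for x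
  proof (rule unitriangular.unitriangular_basis[OF _ that])
    show "unitriangular word_prec G c"
    proof (intro unitriangular.intro wo unitriangular_axioms.intro)
      fix g assume g: "g \<in> G"
      have low: "Poly_Mapping.keys (combo b (P g)) \<subseteq> {w\<in>G. word_prec w g}"
        using keys_combo[of b "P g"] P(1)[OF g] keys_b trans_prec by blast
      show "Poly_Mapping.keys (c g) \<subseteq> {w\<in>G. w = g \<or> word_prec w g}"
        using Poly_Mapping.keys_add[of "b g"] keys_b[OF g] low unfolding c_def by blast
      have "Poly_Mapping.lookup (combo b (P g)) g = 0"
        using word_prec_irrefl by (intro lookup_eq_0_outside[OF low]) auto
      then show "Poly_Mapping.lookup (c g) g = 1"
        using lookup_b_self[OF g] by (simp add: c_def lookup_add)
    qed
  qed
  define C where "C = restrict (\<lambda>g. ?L (c g)) G"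
  have "iq_basis \<alpha> \<xi> G C"
    unfolding iq_basis_def
  proof (intro conjI ballI)
    show "C g \<in> carrier (iqgroup \<alpha> \<xi>)" if "g \<in> G" for g
      using that by (simp add: C_def carrier_iqgroup)
    fix u assume "u \<in> carrier (iqgroup \<alpha> \<xi>)"
    then obtain y where "u = ?L y" by (auto simp: carrier_iqgroup)
    then have u: "u = ?L (combo r y)" by (simp add: L_reduce)
    have "lincomb \<alpha> C p = ?L (combo c p)" if "Poly_Mapping.keys p \<subseteq> G" for p
      unfolding lincomb_B_elt[symmetric]
      by (rule lincomb_cong) (use that in \<open>auto simp: C_def B_elt_conv_qclass\<close>)
    moreover have "Poly_Mapping.keys (combo c p) \<subseteq> G" for p
      using keys_combo[of c p] combo_G unfolding c_def by blast
    ultimately have "Poly_Mapping.keys p \<subseteq> G \<and> u = lincomb \<alpha> C p \<longleftrightarrow> Poly_Mapping.keys p \<subseteq> G \<and> combo r y = combo c p" for p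
      using inj[OF keys_reduce[of y], of "combo c p"] u by auto
    then show "\<exists>!p. Poly_Mapping.keys p \<subseteq> G \<and> u = lincomb \<alpha> C p"
      using basis_c[OF keys_reduce[of y]] by simp
  qed
  moreover have "C \<in> G \<rightarrow>\<^sub>E carrier (iqgroup \<alpha> \<xi>)"
    by (auto simp: C_def carrier_iqgroup)
  moreover have "bar (C g) = C g" if "g \<in> G" for g
  proof -
    have "Poly_Mapping.map \<sigma> (c g) = c g"
      using P(3)[OF that] by (intro poly_mapping_eqI) (simp add: lookup_map_0 \<sigma>_0 c_def)
    then show ?thesis using that by (simp add: C_def bar)
  qed
  moreover have "\<exists>p. Poly_Mapping.keys p \<subseteq> {w \<in> G. word_prec w g} \<and>
                   (\<forall>w. Poly_Mapping.lookup p w \<in> q_int_qpolys) \<and>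
                   C g = ?L (word_bracket \<alpha> g) \<oplus>\<^bsub>qgroup \<alpha>\<^esub>
                         lincomb \<alpha> (\<lambda>w. ?L (word_bracket \<alpha> w)) p" if "g \<in> G" for g
    using P(1,2)[OF that] that by (intro exI[of _ "P g"]) (simp add: L_b C_def c_def)
  \<comment> \<open>Invariance under the involution is, by independence of the good words, invariance of all
    coordinates, so that the correction is unique.\<close>
  moreover have "C' = C" if C': "C' \<in> G \<rightarrow>\<^sub>E carrier (iqgroup \<alpha> \<xi>)"
    "\<forall>g\<in>G. bar (C' g) = C' g \<and> (\<exists>p. Poly_Mapping.keys p \<subseteq> {w \<in> G. word_prec w g} \<and>
                   (\<forall>w. Poly_Mapping.lookup p w \<in> q_int_qpolys) \<and>
                   C' g = ?L (word_bracket \<alpha> g) \<oplus>\<^bsub>qgroup \<alpha>\<^esub>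
                         lincomb \<alpha> (\<lambda>w. ?L (word_bracket \<alpha> w)) p)" for C'
  proof (rule PiE_ext[OF C'(1)])
    show "C \<in> G \<rightarrow>\<^sub>E carrier (iqgroup \<alpha> \<xi>)" by fact
    fix g assume g: "g \<in> G"
    then obtain p where p: "Poly_Mapping.keys p \<subseteq> {w \<in> G. word_prec w g}"
      "\<And>w. Poly_Mapping.lookup p w \<in> q_int_qpolys" "C' g = ?L (b g + combo b p)"
      using C'(2) by (auto simp: L_b)
    have "?L (Poly_Mapping.map \<sigma> (b g + combo b p)) = ?L (b g + combo b p)"
      using C'(2) g p(3) bar by metis
    moreover have "Poly_Mapping.keys (Poly_Mapping.map \<sigma> x) \<subseteq> Poly_Mapping.keys x" for x :: "'i free_alg"
      by (auto simp: in_keys_iff lookup_map_0 \<sigma>_0)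
    ultimately have fixed: "Poly_Mapping.map \<sigma> (b g + combo b p) = b g + combo b p"
      using combo_G by (intro inj) blast+
    have "p = P g"
    proof (rule bar_invariant_correction_unique[of q_int_qpolys \<sigma> p "b g" "P g"])
      show "\<sigma> (Poly_Mapping.lookup (b g + combo b p) w) = Poly_Mapping.lookup (b g + combo b p) w" for w
        using lookup_map_0[of \<sigma> "b g + combo b p" w] \<sigma>_0 unfolding fixed by simp
    qed (use p P(1)[OF g] P(2,3)[OF g] q_int_qpolys_diff \<sigma>_diff fixed_q_int_qpolys_eq_0 in auto)
    then show "C' g = C g" using p(3) g by (simp add: C_def c_def)
  qed
  ultimately show ?thesis unfolding G_def[symmetric] by (intro ex1I[of _ C]) blast+
qed

end
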